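(* Let $\mathfrak{g}$ be a unimodular solvable real Lie algebra equipped with a Vaisman structure $(J,\langle\cdot,\cdot\rangle)$, with fundamental $2$-form $\omega$ and Lee form $\theta\neq 0$. Let $A\in(\ker\theta)^{\perp}$ be the vector with $\theta(A)=1$, and assume the metric is normalized so that $|A|=1$. Then there exists a Kähler flat Lie algebra $\mathfrak{k}$, whose underlying vector space is a linear subspace of $\ker\theta$, such that, setting $D:=\operatorname{ad}_A|_{\ker\theta}$ and $\omega':=\omega|_{\mathfrak{k}\times\mathfrak{k}}$: the form $\omega'$ is the fundamental $2$-form of $\mathfrak{k}$, $\ker\theta=\mathfrak{k}_{\omega'}(JA)$, and $\mathfrak{g}=\mathfrak{k}(D,\omega')$ (with $A$ generating the factor $\mathbb{R}$). Moreover, $D':=D|_{\mathfrak{k}}$ is a skew-symmetric derivation of $\mathfrak{k}$ that commutes with the complex structure of $\mathfrak{k}$.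
   Context: All Lie algebras are real and finite-dimensional. A Lie algebra is unimodular if $\operatorname{tr}(\operatorname{ad}_x)=0$ for all $x$. $d$ denotes the Chevalley–Eilenberg differential (so $d\alpha(x,y)=-\alpha([x,y])$ for a $1$-form $\alpha$). A complex structure on $\mathfrak{g}$ is an endomorphism $J$ with $J^2=-\mathrm{Id}$ and $[Jx,Jy]-[x,y]-J([Jx,y]+[x,Jy])=0$ for all $x,y$. Given a Hermitian inner product $\langle\cdot,\cdot\rangle$ (i.e. $\langle Jx,Jy\rangle=\langle x,y\rangle$), the fundamental $2$-form is $\omega(x,y)=\langle Jx,y\rangle$. $(J,\langle\cdot,\cdot\rangle)$ is an LCK structure on $\mathfrak{g}$ if there is $\theta\in\mathfrak{g}^*$ (the Lee form) with $d\theta=0$ and $d\omega=\theta\wedge\omega$; it is Vaisman if moreover $\nabla\theta=0$, where $\nabla$ is the Levi-Civita connection, given by $\langle\nabla_xy,z\rangle=\frac12(\langle[x,y],z\rangle-\langle[y,z],x\rangle+\langle[z,x],y\rangle)$. Note that $JA\in\ker\theta$. A Kähler structure is a Hermitian structure (with $J$ a complex structure) such that $d\omega=0$. A Kähler flat Lie algebra is a Lie algebra with a Kähler structure whose inner product is flat (the Levi-Civita connection has zero curvature). Central extension: for a Lie algebra $\mathfrak{h}$ and a closed $2$-form $\beta$ on $\mathfrak{h}$, $\mathfrak{h}_\beta(\xi)$ denotes the vector space $\mathbb{R}\xi\oplus\mathfrak{h}$ with bracket $[x,y]_\beta=\beta(x,y)\xi+[x,y]_{\mathfrak{h}}$, $[\xi,x]_\beta=0$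 for $x,y\in\mathfrak{h}$. Double extension: for a derivation $D$ of $\mathfrak{h}_\beta(\xi)$, $\mathfrak{h}(D,\beta):=\mathbb{R}\ltimes_D\mathfrak{h}_\beta(\xi)$, the semidirect product in which a generator of $\mathbb{R}$ acts on $\mathfrak{h}_\beta(\xi)$ by $D$. *)

theory Defs
  imports "HOL-Analysis.Analysis"
begin

text \<open>
  A vector space is a linear subspace \<open>V\<close> of an arbitrary Euclidean space type, which makes it
  finite-dimensional; brackets, forms, metrics and endomorphisms on it are functions of the whole
  type of which only the values on \<open>V\<close> matter.  The metric is always the explicit argument \<open>ip\<close>; the
  inner product of the type itself is used only to compute traces, which do not depend on it.
\<close>

definition linear_on :: "'a::real_vector set \<Rightarrow> ('a \<Rightarrow> 'b::real_vector) \<Rightarrow> bool" where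
  "linear_on V f \<longleftrightarrow>
     (\<forall>x\<in>V. \<forall>y\<in>V. f (x + y) = f x + f y) \<and> (\<forall>c. \<forall>x\<in>V. f (c *\<^sub>R x) = c *\<^sub>R f x)"

definition bilinear_on ::
  "'a::real_vector set \<Rightarrow> ('a \<Rightarrow> 'a \<Rightarrow> 'b::real_vector) \<Rightarrow> bool" where
  "bilinear_on V f \<longleftrightarrow>
     (\<forall>x\<in>V. linear_on V (\<lambda>y. f x y)) \<and> (\<forall>y\<in>V. linear_on V (\<lambda>x. f x y))"

definition endomorphism_on :: "'a::real_vector set \<Rightarrow> ('a \<Rightarrow> 'a) \<Rightarrow> bool" where
  "endomorphism_on V f \<longleftrightarrow> linear_on V f \<and> f ` V \<subseteq> V"


section \<open>Lie algebras\<close>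

definition lie_algebra :: "'a::euclidean_space set \<Rightarrow> ('a \<Rightarrow> 'a \<Rightarrow> 'a) \<Rightarrow> bool" where
  "lie_algebra V br \<longleftrightarrow>
     subspace V \<and> (\<forall>x\<in>V. \<forall>y\<in>V. br x y \<in> V) \<and> bilinear_on V br \<and>
     (\<forall>x\<in>V. br x x = 0) \<and>
     (\<forall>x\<in>V. \<forall>y\<in>V. \<forall>z\<in>V. br x (br y z) + br y (br z x) + br z (br x y) = 0)"

primrec derived_series ::
  "'a::euclidean_space set \<Rightarrow> ('a \<Rightarrow> 'a \<Rightarrow> 'a) \<Rightarrow> nat \<Rightarrow> 'a set" where
  "derived_series V br 0 = V"
| "derived_series V br (Suc n) =
     span {br x y |x y. x \<in> derived_series V br n \<and> y \<in> derived_series V br n}"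

definition lie_solvable :: "'a::euclidean_space set \<Rightarrow> ('a \<Rightarrow> 'a \<Rightarrow> 'a) \<Rightarrow> bool" where
  "lie_solvable V br \<longleftrightarrow> (\<exists>n. derived_series V br n = {0})"

definition endo_trace :: "('a::euclidean_space \<Rightarrow> 'a) \<Rightarrow> real" where
  "endo_trace f = (\<Sum>b\<in>Basis. f b \<bullet> b)"

text \<open>Only for a Lie algebra whose underlying space is the whole type.\<close>

definition unimodular :: "('a::euclidean_space \<Rightarrow> 'a \<Rightarrow> 'a) \<Rightarrow> bool" where
  "unimodular br \<longleftrightarrow> (\<forall>x. endo_trace (br x) = 0)"

definition derivation_on ::
  "'a::euclidean_space set \<Rightarrow> ('a \<Rightarrow> 'a \<Rightarrow> 'a) \<Rightarrow> ('a \<Rightarrow> 'a) \<Rightarrow> bool" where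
  "derivation_on V br D \<longleftrightarrow>
     endomorphism_on V D \<and> (\<forall>x\<in>V. \<forall>y\<in>V. D (br x y) = br (D x) y + br x (D y))"


section \<open>Chevalley--Eilenberg differential and wedge product\<close>

definition d1 :: "('a \<Rightarrow> 'a \<Rightarrow> 'a) \<Rightarrow> ('a \<Rightarrow> real) \<Rightarrow> 'a \<Rightarrow> 'a \<Rightarrow> real" where
  "d1 br \<alpha> x y = - \<alpha> (br x y)"

definition d2 :: "('a \<Rightarrow> 'a \<Rightarrow> 'a) \<Rightarrow> ('a \<Rightarrow> 'a \<Rightarrow> real) \<Rightarrow> 'a \<Rightarrow> 'a \<Rightarrow> 'a \<Rightarrow> real" where
  "d2 br \<beta> x y z = - \<beta> (br x y) z - \<beta> (br y z) x - \<beta> (br z x) y"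

text \<open>Determinant normalization of the wedge product, matching that of \<open>d1\<close> and \<open>d2\<close>.\<close>

definition wedge12 :: "('a \<Rightarrow> real) \<Rightarrow> ('a \<Rightarrow> 'a \<Rightarrow> real) \<Rightarrow> 'a \<Rightarrow> 'a \<Rightarrow> 'a \<Rightarrow> real" where
  "wedge12 \<alpha> \<beta> x y z = \<alpha> x * \<beta> y z + \<alpha> y * \<beta> z x + \<alpha> z * \<beta> x y"

definition two_form_on :: "'a::real_vector set \<Rightarrow> ('a \<Rightarrow> 'a \<Rightarrow> real) \<Rightarrow> bool" where
  "two_form_on V \<beta> \<longleftrightarrow> bilinear_on V \<beta> \<and> (\<forall>x\<in>V. \<beta> x x = 0)"

definition closed_two_form ::
  "'a::euclidean_space set \<Rightarrow> ('a \<Rightarrow> 'a \<Rightarrow> 'a) \<Rightarrow> ('a \<Rightarrow> 'a \<Rightarrow> real) \<Rightarrow> bool" where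
  "closed_two_form V br \<beta> \<longleftrightarrow>
     two_form_on V \<beta> \<and> (\<forall>x\<in>V. \<forall>y\<in>V. \<forall>z\<in>V. d2 br \<beta> x y z = 0)"


section \<open>Hermitian, Vaisman and Kaehler structures\<close>

definition inner_product_on :: "'a::real_vector set \<Rightarrow> ('a \<Rightarrow> 'a \<Rightarrow> real) \<Rightarrow> bool" where
  "inner_product_on V ip \<longleftrightarrow>
     bilinear_on V ip \<and> (\<forall>x\<in>V. \<forall>y\<in>V. ip x y = ip y x) \<and> (\<forall>x\<in>V. x \<noteq> 0 \<longrightarrow> 0 < ip x x)"

text \<open>The vector \<open>\<nabla>\<^sub>x y\<close>; it is well defined when \<open>ip\<close> is an inner product on \<open>V\<close>.\<close>

definition levi_civita ::
  "'a::euclidean_space set \<Rightarrow> ('a \<Rightarrow> 'a \<Rightarrow> 'a) \<Rightarrow> ('a \<Rightarrow> 'a \<Rightarrow> real) \<Rightarrow> 'a \<Rightarrow> 'a \<Rightarrow> 'a" where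
  "levi_civita V br ip x y =
     (THE w. w \<in> V \<and> (\<forall>z\<in>V. ip w z = (ip (br x y) z - ip (br y z) x + ip (br z x) y) / 2))"

text \<open>\<open>(\<nabla>\<^sub>x \<alpha>)(y) = x(\<alpha>(y)) - \<alpha>(\<nabla>\<^sub>x y)\<close>, whose first term vanishes for left-invariant objects.\<close>

definition cov_deriv1 ::
  "'a::euclidean_space set \<Rightarrow> ('a \<Rightarrow> 'a \<Rightarrow> 'a) \<Rightarrow> ('a \<Rightarrow> 'a \<Rightarrow> real) \<Rightarrow> ('a \<Rightarrow> real) \<Rightarrow>
     'a \<Rightarrow> 'a \<Rightarrow> real" where
  "cov_deriv1 V br ip \<alpha> x y = - \<alpha> (levi_civita V br ip x y)"

definition curvature ::
  "'a::euclidean_space set \<Rightarrow> ('a \<Rightarrow> 'a \<Rightarrow> 'a) \<Rightarrow> ('a \<Rightarrow> 'a \<Rightarrow> real) \<Rightarrow> 'a \<Rightarrow> 'a \<Rightarrow> 'a \<Rightarrow> 'a" where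
  "curvature V br ip x y z =
     levi_civita V br ip x (levi_civita V br ip y z)
     - levi_civita V br ip y (levi_civita V br ip x z)
     - levi_civita V br ip (br x y) z"

definition flat_metric ::
  "'a::euclidean_space set \<Rightarrow> ('a \<Rightarrow> 'a \<Rightarrow> 'a) \<Rightarrow> ('a \<Rightarrow> 'a \<Rightarrow> real) \<Rightarrow> bool" where
  "flat_metric V br ip \<longleftrightarrow> (\<forall>x\<in>V. \<forall>y\<in>V. \<forall>z\<in>V. curvature V br ip x y z = 0)"

definition complex_structure ::
  "'a::euclidean_space set \<Rightarrow> ('a \<Rightarrow> 'a \<Rightarrow> 'a) \<Rightarrow> ('a \<Rightarrow> 'a) \<Rightarrow> bool" where
  "complex_structure V br J \<longleftrightarrow>
     endomorphism_on V J \<and> (\<forall>x\<in>V. J (J x) = - x) \<and>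
     (\<forall>x\<in>V. \<forall>y\<in>V. br (J x) (J y) - br x y - J (br (J x) y + br x (J y)) = 0)"

definition hermitian_structure ::
  "'a::euclidean_space set \<Rightarrow> ('a \<Rightarrow> 'a \<Rightarrow> 'a) \<Rightarrow> ('a \<Rightarrow> 'a) \<Rightarrow> ('a \<Rightarrow> 'a \<Rightarrow> real) \<Rightarrow> bool" where
  "hermitian_structure V br J ip \<longleftrightarrow>
     complex_structure V br J \<and> inner_product_on V ip \<and>
     (\<forall>x\<in>V. \<forall>y\<in>V. ip (J x) (J y) = ip x y)"

definition fundamental_form ::
  "('a \<Rightarrow> 'a) \<Rightarrow> ('a \<Rightarrow> 'a \<Rightarrow> real) \<Rightarrow> 'a \<Rightarrow> 'a \<Rightarrow> real" where
  "fundamental_form J ip x y = ip (J x) y"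

definition lck_structure ::
  "'a::euclidean_space set \<Rightarrow> ('a \<Rightarrow> 'a \<Rightarrow> 'a) \<Rightarrow> ('a \<Rightarrow> 'a) \<Rightarrow> ('a \<Rightarrow> 'a \<Rightarrow> real) \<Rightarrow>
     ('a \<Rightarrow> real) \<Rightarrow> bool" where
  "lck_structure V br J ip \<theta> \<longleftrightarrow>
     hermitian_structure V br J ip \<and> linear_on V \<theta> \<and>
     (\<forall>x\<in>V. \<forall>y\<in>V. d1 br \<theta> x y = 0) \<and>
     (\<forall>x\<in>V. \<forall>y\<in>V. \<forall>z\<in>V.
        d2 br (fundamental_form J ip) x y z = wedge12 \<theta> (fundamental_form J ip) x y z)"

definition vaisman_structure ::
  "'a::euclidean_space set \<Rightarrow> ('a \<Rightarrow> 'a \<Rightarrow> 'a) \<Rightarrow> ('a \<Rightarrow> 'a) \<Rightarrow> ('a \<Rightarrow> 'a \<Rightarrow> real) \<Rightarrow>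
     ('a \<Rightarrow> real) \<Rightarrow> bool" where
  "vaisman_structure V br J ip \<theta> \<longleftrightarrow>
     lck_structure V br J ip \<theta> \<and> (\<forall>x\<in>V. \<forall>y\<in>V. cov_deriv1 V br ip \<theta> x y = 0)"

definition kaehler_structure ::
  "'a::euclidean_space set \<Rightarrow> ('a \<Rightarrow> 'a \<Rightarrow> 'a) \<Rightarrow> ('a \<Rightarrow> 'a) \<Rightarrow> ('a \<Rightarrow> 'a \<Rightarrow> real) \<Rightarrow> bool" where
  "kaehler_structure V br J ip \<longleftrightarrow>
     hermitian_structure V br J ip \<and>
     (\<forall>x\<in>V. \<forall>y\<in>V. \<forall>z\<in>V. d2 br (fundamental_form J ip) x y z = 0)"

definition kaehler_flat_lie_algebra ::
  "'a::euclidean_space set \<Rightarrow> ('a \<Rightarrow> 'a \<Rightarrow> 'a) \<Rightarrow> ('a \<Rightarrow> 'a) \<Rightarrow> ('a \<Rightarrow> 'a \<Rightarrow> real) \<Rightarrow> bool" where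
  "kaehler_flat_lie_algebra V br J ip \<longleftrightarrow>
     lie_algebra V br \<and> kaehler_structure V br J ip \<and> flat_metric V br ip"


section \<open>Central and double extensions, as internal direct sums\<close>

text \<open>
  \<open>(V, brV)\<close> is the central extension of \<open>(H, brH)\<close> by the closed form \<open>\<beta>\<close>, with \<open>\<xi>\<close> the added
  generator: \<open>V\<close> is the internal direct sum of \<open>\<real>\<xi>\<close> and \<open>H\<close>.
\<close>

definition is_central_extension ::
  "'a::euclidean_space set \<Rightarrow> ('a \<Rightarrow> 'a \<Rightarrow> 'a) \<Rightarrow> ('a \<Rightarrow> 'a \<Rightarrow> real) \<Rightarrow> 'a \<Rightarrow>
     'a set \<Rightarrow> ('a \<Rightarrow> 'a \<Rightarrow> 'a) \<Rightarrow> bool" where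
  "is_central_extension H brH \<beta> \<xi> V brV \<longleftrightarrow>
     lie_algebra H brH \<and> closed_two_form H brH \<beta> \<and>
     \<xi> \<notin> H \<and> V = {s *\<^sub>R \<xi> + x |s x. x \<in> H} \<and>
     (\<forall>s t. \<forall>x\<in>H. \<forall>y\<in>H. brV (s *\<^sub>R \<xi> + x) (t *\<^sub>R \<xi> + y) = \<beta> x y *\<^sub>R \<xi> + brH x y)"

text \<open>
  \<open>(W, brW)\<close> is the semidirect product \<open>\<real>a \<ltimes>\<^sub>D V\<close>, so that \<open>[a, v] = D v\<close>.
\<close>

definition is_semidirect_product ::
  "'a::euclidean_space set \<Rightarrow> ('a \<Rightarrow> 'a \<Rightarrow> 'a) \<Rightarrow> ('a \<Rightarrow> 'a) \<Rightarrow> 'a \<Rightarrow>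
     'a set \<Rightarrow> ('a \<Rightarrow> 'a \<Rightarrow> 'a) \<Rightarrow> bool" where
  "is_semidirect_product V brV D a W brW \<longleftrightarrow>
     lie_algebra V brV \<and> derivation_on V brV D \<and>
     a \<notin> V \<and> W = {s *\<^sub>R a + v |s v. v \<in> V} \<and>
     (\<forall>s t. \<forall>v\<in>V. \<forall>w\<in>V.
        brW (s *\<^sub>R a + v) (t *\<^sub>R a + w) = s *\<^sub>R D w - t *\<^sub>R D v + brV v w)"

definition is_double_extension ::
  "'a::euclidean_space set \<Rightarrow> ('a \<Rightarrow> 'a \<Rightarrow> 'a) \<Rightarrow> ('a \<Rightarrow> 'a) \<Rightarrow> ('a \<Rightarrow> 'a \<Rightarrow> real) \<Rightarrow>
     'a \<Rightarrow> 'a \<Rightarrow> 'a set \<Rightarrow> ('a \<Rightarrow> 'a \<Rightarrow> 'a) \<Rightarrow> bool" where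
  "is_double_extension H brH D \<beta> a \<xi> W brW \<longleftrightarrow>
     (\<exists>V brV. is_central_extension H brH \<beta> \<xi> V brV \<and> is_semidirect_product V brV D a W brW)"

end

theory Submission
  imports Defs
begin

text \<open>
  Parallelism of the Lee form makes \<open>ad A\<close> skew-symmetric; with the integrability of \<open>J\<close> and
  \<open>d\<omega> = \<theta> \<and> \<omega>\<close>, \<open>ad A\<close> commutes with \<open>J\<close>, \<open>ad (J A)\<close> is skew-symmetric, and the
  \<open>J A\<close>-component of the bracket of \<open>ker \<theta>\<close> is \<open>\<omega>\<close>.  Unimodularity gives
  \<open>\<Sum> [e, J e] = (dim \<gg> - 2) J A\<close> over an orthonormal basis, so \<open>J A\<close> lies in the derived
  algebra (unless \<open>dim \<gg> = 2\<close>); in a solvable Lie algebra a skew-symmetric inner derivation by such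
  an element vanishes, so \<open>J A\<close> is central.  Hence the orthogonal complement \<open>K\<close> of \<open>A\<close> and \<open>J A\<close>,
  with the projected bracket, is a unimodular solvable Kaehler Lie algebra.

  Such an algebra is flat.  Its Ricci form is exact, which by unimodularity forces the scalar
  curvature to vanish, here by means of the Bianchi identity.  By Milnor's induction over a
  codimension-one ideal with unit normal \<open>b\<close>, the scalar curvature of a solvable metric Lie algebra
  decreases by the squared norm of the symmetric part of \<open>ad b\<close>; so if it vanishes, each \<open>ad b\<close> is a
  skew-symmetric derivation, and an extension of a flat algebra by such a derivation is flat.
\<close>

section \<open>Orthonormal bases of subspaces\<close>

definition orthonormal_basis :: "'a::euclidean_space set \<Rightarrow> 'a set \<Rightarrow> bool" where
  "orthonormal_basis V B \<longleftrightarrow>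
     finite B \<and> pairwise orthogonal B \<and> (\<forall>e\<in>B. norm e = 1) \<and> span B = V"

lemma orthonormal_basis_exists:
  assumes "subspace V"
  obtains B where "orthonormal_basis V B"
proof -
  obtain B where B: "B \<subseteq> V" "pairwise orthogonal B" "\<And>x. x \<in> B \<Longrightarrow> norm x = 1"
    "independent B" "card B = dim V" "span B = V"
    using orthonormal_basis_subspace[OF assms] by metis
  have "orthonormal_basis V B"
    using B independent_imp_finite[OF B(4)] by (auto simp: orthonormal_basis_def)
  then show ?thesis using that by blast
qed

lemma orthonormal_basis_Basis: "orthonormal_basis UNIV Basis"
  by (auto simp: orthonormal_basis_def pairwise_def orthogonal_def inner_Basis)

lemma orthonormal_basis_inner:
  assumes "orthonormal_basis V B" "e \<in> B" "f \<in> B"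
  shows "e \<bullet> f = (if e = f then 1 else 0)"
  using assms by (auto simp: orthonormal_basis_def pairwise_def orthogonal_def norm_eq_1)

lemma orthonormal_basis_finite: "orthonormal_basis V B \<Longrightarrow> finite B"
  by (simp add: orthonormal_basis_def)

lemma orthonormal_basis_in: "orthonormal_basis V B \<Longrightarrow> e \<in> B \<Longrightarrow> e \<in> V"
  by (auto simp: orthonormal_basis_def intro: span_base)

lemma orthonormal_basis_expand:
  assumes B: "orthonormal_basis V B" and "x \<in> V"
  shows "(\<Sum>e\<in>B. (x \<bullet> e) *\<^sub>R e) = x"
proof -
  have "x \<in> span B" using assms by (simp add: orthonormal_basis_def)
  then show ?thesis
  proof (induction rule: span_induct_alt)
    case base show ?case by simp
  next
    case (step c b y)
    have "(\<Sum>e\<in>B. (b \<bullet> e) *\<^sub>R e) = (\<Sum>e\<in>B. if e = b then b else 0)"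
      by (rule sum.cong) (use step B in \<open>auto simp: orthonormal_basis_inner\<close>)
    also have "\<dots> = b" using step B by (simp add: orthonormal_basis_finite)
    finally have "(\<Sum>e\<in>B. (b \<bullet> e) *\<^sub>R e) = b" .
    then have "(\<Sum>e\<in>B. ((c *\<^sub>R b) \<bullet> e) *\<^sub>R e) = c *\<^sub>R b"
      by (simp add: scaleR_sum_right[symmetric] flip: scaleR_scaleR)
    then show ?case using step
      by (simp add: inner_add_left scaleR_left_distrib sum.distrib)
  qed
qed

lemma orthonormal_basis_inner_sum:
  assumes B: "orthonormal_basis V B" and "x \<in> V"
  shows "(\<Sum>e\<in>B. (x \<bullet> e) * (e \<bullet> y)) = x \<bullet> y"
proof -
  have "x \<bullet> y = (\<Sum>e\<in>B. (x \<bullet> e) *\<^sub>R e) \<bullet> y"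
    using orthonormal_basis_expand[OF assms] by simp
  then show ?thesis by (simp add: inner_sum_left)
qed

lemma orthonormal_basis_linear_expand:
  assumes B: "orthonormal_basis V B" and "x \<in> V" "linear f"
  shows "f x = (\<Sum>e\<in>B. (x \<bullet> e) *\<^sub>R f e)"
proof -
  have "f x = f (\<Sum>e\<in>B. (x \<bullet> e) *\<^sub>R e)"
    using orthonormal_basis_expand[OF B \<open>x \<in> V\<close>] by simp
  then show ?thesis using \<open>linear f\<close> by (simp add: linear_sum linear_cmul)
qed

text \<open>Expand the first slot of each diagonal term in \<open>C\<close>, exchange the sums, and
  collapse the sum over \<open>B\<close> in the second slot.\<close>

lemma bilinear_trace_basis_independent:
  fixes f :: "'a::euclidean_space \<Rightarrow> 'a \<Rightarrow> 'b::real_vector"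
  assumes f: "bilinear f" and B: "orthonormal_basis V B" and C: "orthonormal_basis V C"
  shows "(\<Sum>e\<in>B. f e e) = (\<Sum>c\<in>C. f c c)"
proof -
  have l: "linear (\<lambda>x. f x y)" "linear (f x)" for x y
    using f by (simp_all add: bilinear_def)
  have "(\<Sum>e\<in>B. f e e) = (\<Sum>e\<in>B. \<Sum>c\<in>C. (e \<bullet> c) *\<^sub>R f c e)"
    by (intro sum.cong refl orthonormal_basis_linear_expand[OF C _ l(1)] orthonormal_basis_in[OF B])
  also have "\<dots> = (\<Sum>c\<in>C. \<Sum>e\<in>B. (c \<bullet> e) *\<^sub>R f c e)"
    by (subst sum.swap) (simp add: inner_commute)
  also have "\<dots> = (\<Sum>c\<in>C. f c c)"
    by (intro sum.cong refl orthonormal_basis_linear_expand[OF B _ l(2), symmetric]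
        orthonormal_basis_in[OF C])
  finally show ?thesis .
qed

text \<open>In coordinates with respect to \<open>B\<close> both sides become the same double sum of
  products of matrix entries; invariance of \<open>V\<close> is what permits the expansion.\<close>

lemma trace_cyclic:
  assumes B: "orthonormal_basis V B" and f: "linear f" "f ` V \<subseteq> V" and g: "linear g" "g ` V \<subseteq> V"
  shows "(\<Sum>e\<in>B. f (g e) \<bullet> e) = (\<Sum>e\<in>B. g (f e) \<bullet> e)"
proof -
  have *: "(\<Sum>e\<in>B. f (g e) \<bullet> e) = (\<Sum>e\<in>B. \<Sum>c\<in>B. (g e \<bullet> c) * (f c \<bullet> e))"
    if "linear f" "g ` V \<subseteq> V" for f g
  proof (rule sum.cong[OF refl])
    fix e assume "e \<in> B"
    then have "g e \<in> V" using that B orthonormal_basis_in by blast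
    then show "f (g e) \<bullet> e = (\<Sum>c\<in>B. (g e \<bullet> c) * (f c \<bullet> e))"
      using orthonormal_basis_linear_expand[OF B _ \<open>linear f\<close>] by (simp add: inner_sum_left)
  qed
  show ?thesis
    unfolding *[OF f(1) g(2)] *[OF g(1) f(2)] by (subst sum.swap) (simp add: mult.commute)
qed

lemma orthonormal_basis_isometry:
  assumes B: "orthonormal_basis V B" and J: "linear J" "J ` V = V"
    and iso: "\<And>x y. x \<in> V \<Longrightarrow> y \<in> V \<Longrightarrow> J x \<bullet> J y = x \<bullet> y"
  shows "orthonormal_basis V (J ` B)" "inj_on J B"
proof -
  have i: "J e \<bullet> J f = (if e = f then 1 else 0)" if "e \<in> B" "f \<in> B" for e f
    using that iso orthonormal_basis_in[OF B] orthonormal_basis_inner[OF B] by simp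
  have "span (J ` B) = V"
    using linear_span_image[OF J(1)] B J(2) by (simp add: orthonormal_basis_def)
  then show "orthonormal_basis V (J ` B)"
    using i orthonormal_basis_finite[OF B]
    by (auto simp: orthonormal_basis_def pairwise_def orthogonal_def norm_eq_1)
  show "inj_on J B"
    by (rule inj_onI) (metis i zero_neq_one)
qed

lemma bilinear_trace_isometry:
  fixes f :: "'a::euclidean_space \<Rightarrow> 'a \<Rightarrow> 'b::real_vector"
  assumes f: "bilinear f" and B: "orthonormal_basis V B" and J: "linear J" "J ` V = V"
    and iso: "\<And>x y. x \<in> V \<Longrightarrow> y \<in> V \<Longrightarrow> J x \<bullet> J y = x \<bullet> y"
  shows "(\<Sum>e\<in>B. f (J e) (J e)) = (\<Sum>e\<in>B. f e e)"
proof -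
  have "(\<Sum>e\<in>B. f (J e) (J e)) = (\<Sum>e\<in>J ` B. f e e)"
    by (subst sum.reindex[OF orthonormal_basis_isometry(2)[OF B J iso]]) auto
  also have "\<dots> = (\<Sum>e\<in>B. f e e)"
    by (rule bilinear_trace_basis_independent[OF f orthonormal_basis_isometry(1)[OF B J iso] B])
  finally show ?thesis .
qed

section \<open>Metric Lie algebras and the Levi-Civita connection\<close>

text \<open>Minus the scalar curvature when the Lie algebra is unimodular.\<close>

definition neg_scal :: "('a \<Rightarrow> 'a \<Rightarrow> 'a::euclidean_space) \<Rightarrow> 'a set \<Rightarrow> real" where
  "neg_scal br B = (\<Sum>i\<in>B. \<Sum>j\<in>B. br i j \<bullet> br i j) / 4 + (\<Sum>i\<in>B. \<Sum>j\<in>B. br i (br i j) \<bullet> j) / 2"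

text \<open>The bracket is bilinear on the whole type, but it is a Lie bracket on \<open>V\<close> only.\<close>

locale metric_lie_algebra =
  fixes V :: "'a::euclidean_space set" and br :: "'a \<Rightarrow> 'a \<Rightarrow> 'a"
  assumes subspace: "subspace V" and bilin: "bilinear br"
    and closed: "\<And>x y. x \<in> V \<Longrightarrow> y \<in> V \<Longrightarrow> br x y \<in> V"
    and self: "\<And>x. x \<in> V \<Longrightarrow> br x x = 0"
    and jacobi: "\<And>x y z. x \<in> V \<Longrightarrow> y \<in> V \<Longrightarrow> z \<in> V \<Longrightarrow>
      br x (br y z) + br y (br z x) + br z (br x y) = 0"
begin

sublocale br: bounded_bilinear br
  using bilin by (simp add: bilinear_conv_bounded_bilinear)

lemma antisym: "x \<in> V \<Longrightarrow> y \<in> V \<Longrightarrow> br y x = - br x y"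
  using self[of "x + y"] self[of x] self[of y] subspace
  by (simp add: subspace_add br.add_left br.add_right eq_neg_iff_add_eq_0 add.commute)

lemma is_lie_algebra: "lie_algebra V br"
  using subspace closed self jacobi
  by (auto simp: lie_algebra_def bilinear_on_def linear_on_def br.add_left br.add_right
      br.scaleR_left br.scaleR_right)

definition nabla :: "'a \<Rightarrow> 'a \<Rightarrow> 'a" where
  "nabla = levi_civita V br (\<bullet>)"

text \<open>Discharges the definite description in \<open>levi_civita\<close>: the Koszul expression
  is linear in \<open>z\<close>, so it has a unique Riesz representative in \<open>V\<close>, built
  from its values on an orthonormal basis.\<close>

lemma nabla_aux:
  "nabla x y \<in> V \<and> (\<forall>z\<in>V. nabla x y \<bullet> z = (br x y \<bullet> z - br y z \<bullet> x + br z x \<bullet> y) / 2)"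
proof -
  define k where "k z = (br x y \<bullet> z - br y z \<bullet> x + br z x \<bullet> y) / 2" for z
  have lin: "linear k"
    by (rule linearI) (auto simp: k_def br.add_left br.add_right br.scaleR_left br.scaleR_right
        inner_add_left inner_add_right field_simps)
  obtain B where B: "orthonormal_basis V B" using orthonormal_basis_exists subspace by blast
  define w where "w = (\<Sum>e\<in>B. k e *\<^sub>R e)"
  have wV: "w \<in> V" unfolding w_def
    by (intro subspace_sum subspace subspace_scale orthonormal_basis_in[OF B])
  have wk: "w \<bullet> z = k z" if "z \<in> V" for z
    using orthonormal_basis_linear_expand[OF B that lin]
    by (simp add: w_def inner_sum_left inner_commute[of z] mult.commute)
  have "\<exists>!w. w \<in> V \<and> (\<forall>z\<in>V. w \<bullet> z = k z)"
  proof (rule ex1I[of _ w])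
    show "w \<in> V \<and> (\<forall>z\<in>V. w \<bullet> z = k z)" using wV wk by blast
  next
    fix v assume v: "v \<in> V \<and> (\<forall>z\<in>V. v \<bullet> z = k z)"
    then have "v - w \<in> V" using wV subspace by (simp add: subspace_diff)
    then have "(v - w) \<bullet> (v - w) = 0" using v wk by (simp add: inner_diff_left)
    then show "v = w" by simp
  qed
  from theI'[OF this] show ?thesis
    unfolding nabla_def levi_civita_def k_def by blast
qed

lemma nabla_in [simp]: "nabla x y \<in> V"
  using nabla_aux by blast

lemma koszul: "z \<in> V \<Longrightarrow> nabla x y \<bullet> z = (br x y \<bullet> z - br y z \<bullet> x + br z x \<bullet> y) / 2"
  using nabla_aux by blast

lemma eqI:
  assumes "x \<in> V" "y \<in> V" "\<And>z. z \<in> V \<Longrightarrow> x \<bullet> z = y \<bullet> z"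
  shows "x = y"
proof -
  have "x - y \<in> V" using assms subspace by (simp add: subspace_diff)
  then have "(x - y) \<bullet> (x - y) = 0" using assms(3) by (simp add: inner_diff_left)
  then show ?thesis by simp
qed

lemma nabla_unique:
  assumes "w \<in> V" "\<And>z. z \<in> V \<Longrightarrow> w \<bullet> z = (br x y \<bullet> z - br y z \<bullet> x + br z x \<bullet> y) / 2"
  shows "nabla x y = w"
  by (rule eqI) (auto simp: assms koszul)

text \<open>The Koszul formula restricts only \<open>z\<close> to \<open>V\<close>, so bilinearity
  holds on the whole type and the calculus of bounded bilinear maps becomes available.\<close>

lemma bilinear_nabla: "bilinear nabla"
  unfolding bilinear_def
  by (auto intro!: linearI eqI subspace_add subspace_scale
      simp: subspace koszul br.add_left br.add_right br.scaleR_left br.scaleR_right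
        inner_add_left inner_add_right field_simps)

sublocale nabla: bounded_bilinear nabla
  using bilinear_nabla by (simp add: bilinear_conv_bounded_bilinear)

text \<open>Metric compatibility: inner products of left-invariant fields are constant.\<close>

lemma nabla_skew: "x \<in> V \<Longrightarrow> y \<in> V \<Longrightarrow> z \<in> V \<Longrightarrow> nabla x y \<bullet> z = - (y \<bullet> nabla x z)"
  using antisym[of x y] antisym[of x z] antisym[of y z]
  by (simp add: inner_commute[of y "nabla x z"] koszul field_simps)

lemma nabla_skew': "x \<in> V \<Longrightarrow> y \<in> V \<Longrightarrow> z \<in> V \<Longrightarrow> nabla x y \<bullet> z = - (nabla x z \<bullet> y)"
  using nabla_skew[of x y z] by (simp add: inner_commute)

lemma torsion_free: "x \<in> V \<Longrightarrow> y \<in> V \<Longrightarrow> nabla x y - nabla y x = br x y"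
proof (rule eqI)
  fix z assume *: "x \<in> V" "y \<in> V" "z \<in> V"
  then show "(nabla x y - nabla y x) \<bullet> z = br x y \<bullet> z"
    using antisym[of x y] antisym[of x z] antisym[of y z]
    by (simp add: inner_diff_left koszul field_simps)
qed (auto intro: subspace_diff[OF subspace] closed)

section \<open>Riemann curvature and scalar curvature in terms of the connection\<close>

definition riem :: "'a \<Rightarrow> 'a \<Rightarrow> 'a \<Rightarrow> 'a" where
  "riem x y z = nabla x (nabla y z) - nabla y (nabla x z) - nabla (br x y) z"

lemma curvature_eq: "curvature V br (\<bullet>) x y z = riem x y z"
  by (simp add: curvature_def riem_def nabla_def)

lemma flat_iff: "flat_metric V br (\<bullet>) \<longleftrightarrow> (\<forall>x\<in>V. \<forall>y\<in>V. \<forall>z\<in>V. riem x y z = 0)"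
  by (simp add: flat_metric_def curvature_eq)

lemma riem_skew:
  assumes "x \<in> V" "y \<in> V" "z \<in> V" "w \<in> V"
  shows "riem x y z \<bullet> w = - (riem x y w \<bullet> z)"
proof -
  have "nabla x (nabla y z) \<bullet> w = nabla y (nabla x w) \<bullet> z"
    "nabla y (nabla x z) \<bullet> w = nabla x (nabla y w) \<bullet> z"
    "nabla (br x y) z \<bullet> w = - (nabla (br x y) w \<bullet> z)"
    using assms nabla_skew[of x "nabla y z" w] nabla_skew[of y z "nabla x w"]
      nabla_skew[of y "nabla x z" w] nabla_skew[of x z "nabla y w"] nabla_skew[of "br x y" z w]
    by (simp_all add: closed inner_commute)
  then show ?thesis by (simp add: riem_def inner_diff_left)
qed

lemma riem_left: "riem (s *\<^sub>R x + x') y z = s *\<^sub>R riem x y z + riem x' y z"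
  and riem_middle: "riem x (s *\<^sub>R y + y') z = s *\<^sub>R riem x y z + riem x y' z"
  and riem_right: "riem x y (s *\<^sub>R z + z') = s *\<^sub>R riem x y z + riem x y z'"
  by (simp_all add: riem_def nabla.add_left nabla.add_right nabla.scaleR_left nabla.scaleR_right
      br.add_left br.add_right br.scaleR_left br.scaleR_right algebra_simps)

lemma riem_antisym: "x \<in> V \<Longrightarrow> y \<in> V \<Longrightarrow> riem y x z = - riem x y z"
  using antisym[of x y] by (simp add: riem_def nabla.minus_left)

text \<open>First Bianchi identity: applying torsion-freeness twice turns the cyclic sum into the
  Jacobi identity.\<close>

lemma bianchi:
  assumes "x \<in> V" "y \<in> V" "z \<in> V"
  shows "riem x y z + riem y z x + riem z x y = 0"
proof -
  have *: "nabla a (nabla b c) - nabla a (nabla c b) - nabla (br b c) a = br a (br b c)"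
    if "a \<in> V" "b \<in> V" "c \<in> V" for a b c
    using torsion_free[OF that(1) closed[OF that(2,3)]] torsion_free[OF that(2,3)]
    by (simp flip: nabla.diff_right)
  show ?thesis
    using *[OF assms] *[OF assms(2,3,1)] *[OF assms(3,1,2)] jacobi[OF assms]
    unfolding riem_def by (simp add: algebra_simps)
qed

text \<open>Expand \<open>nabla i j\<close> in the basis; skew-symmetry of \<open>nabla i\<close>
  and completeness of the basis then contract the triple sum again.\<close>

lemma sum_nabla_nabla:
  assumes B: "orthonormal_basis V B"
  shows "(\<Sum>i\<in>B. \<Sum>j\<in>B. nabla (nabla i j) i \<bullet> j) = - (\<Sum>i\<in>B. \<Sum>j\<in>B. nabla i j \<bullet> nabla j i)"
proof -
  note BV = orthonormal_basis_in[OF B]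
  have lin: "linear (\<lambda>x. nabla x i \<bullet> j)" for i j
    by (rule linearI) (simp_all add: nabla.add_left nabla.scaleR_left inner_add_left)
  have "(\<Sum>i\<in>B. \<Sum>j\<in>B. nabla (nabla i j) i \<bullet> j) =
      (\<Sum>i\<in>B. \<Sum>j\<in>B. \<Sum>k\<in>B. (nabla i j \<bullet> k) * (nabla k i \<bullet> j))"
    by (intro sum.cong refl) (simp add: orthonormal_basis_linear_expand[OF B _ lin])
  also have "\<dots> = (\<Sum>i\<in>B. \<Sum>j\<in>B. \<Sum>k\<in>B. - ((nabla i k \<bullet> j) * (j \<bullet> nabla k i)))"
    by (intro sum.cong refl, subst nabla_skew'[OF BV BV BV]) (simp_all add: inner_commute)
  also have "\<dots> = (\<Sum>i\<in>B. \<Sum>k\<in>B. \<Sum>j\<in>B. - ((nabla i k \<bullet> j) * (j \<bullet> nabla k i)))"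
    by (intro sum.cong refl sum.swap)
  also have "\<dots> = (\<Sum>i\<in>B. \<Sum>k\<in>B. - (nabla i k \<bullet> nabla k i))"
    by (intro sum.cong refl) (simp add: sum_negf orthonormal_basis_inner_sum[OF B])
  finally show ?thesis by (simp add: sum_negf)
qed

text \<open>By torsion-freeness the two sums in \<open>neg_scal\<close> equal
  \<open>2 * N - 2 * T\<close> and \<open>T - N - 2 * Q\<close>; with \<open>Q = - T\<close> the
  squared norm \<open>N\<close> cancels.\<close>

lemma neg_scal_nabla:
  assumes B: "orthonormal_basis V B"
  shows "neg_scal br B = (\<Sum>i\<in>B. \<Sum>j\<in>B. nabla i j \<bullet> nabla j i)"
proof -
  note BV = orthonormal_basis_in[OF B]
  define N where "N = (\<Sum>i\<in>B. \<Sum>j\<in>B. nabla i j \<bullet> nabla i j)"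
  define T where "T = (\<Sum>i\<in>B. \<Sum>j\<in>B. nabla i j \<bullet> nabla j i)"
  define Q where "Q = (\<Sum>i\<in>B. \<Sum>j\<in>B. nabla (nabla i j) i \<bullet> j)"
  have Q: "Q = - T" using sum_nabla_nabla[OF B] by (simp add: Q_def T_def)
  have N': "(\<Sum>i\<in>B. \<Sum>j\<in>B. nabla j i \<bullet> nabla j i) = N"
    unfolding N_def by (rule sum.swap)
  have Q': "(\<Sum>i\<in>B. \<Sum>j\<in>B. nabla (nabla j i) i \<bullet> j) = - Q"
  proof -
    have "(\<Sum>i\<in>B. \<Sum>j\<in>B. nabla (nabla j i) i \<bullet> j) = (\<Sum>i\<in>B. \<Sum>j\<in>B. nabla (nabla i j) j \<bullet> i)"
      by (rule sum.swap)
    also have "\<dots> = (\<Sum>i\<in>B. \<Sum>j\<in>B. - (nabla (nabla i j) i \<bullet> j))"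
      by (intro sum.cong refl nabla_skew'[OF nabla_in BV BV])
    finally show ?thesis by (simp add: sum_negf Q_def)
  qed
  have "(\<Sum>i\<in>B. \<Sum>j\<in>B. br i j \<bullet> br i j) =
      (\<Sum>i\<in>B. \<Sum>j\<in>B. nabla i j \<bullet> nabla i j + nabla j i \<bullet> nabla j i - 2 * (nabla i j \<bullet> nabla j i))"
    by (intro sum.cong refl)
      (simp add: BV inner_commute algebra_simps flip: torsion_free)
  also have "\<dots> = 2 * N - 2 * T"
    by (simp add: sum.distrib sum_subtractf N' T_def sum_distrib_left) (simp add: N_def)
  finally have 1: "(\<Sum>i\<in>B. \<Sum>j\<in>B. br i j \<bullet> br i j) = 2 * N - 2 * T" .
  have "(\<Sum>i\<in>B. \<Sum>j\<in>B. br i (br i j) \<bullet> j) =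
      (\<Sum>i\<in>B. \<Sum>j\<in>B. nabla i j \<bullet> nabla j i - nabla i j \<bullet> nabla i j
         - nabla (nabla i j) i \<bullet> j + nabla (nabla j i) i \<bullet> j)"
  proof (intro sum.cong refl)
    fix i j assume "i \<in> B" "j \<in> B"
    then have ij: "i \<in> V" "j \<in> V" using BV by auto
    have "br i (br i j) \<bullet> j = nabla i (br i j) \<bullet> j - nabla (br i j) i \<bullet> j"
      using torsion_free[OF ij(1) closed[OF ij]] by (simp flip: inner_diff_left)
    also have "nabla i (br i j) \<bullet> j = - (br i j \<bullet> nabla i j)"
      by (rule nabla_skew) (use ij closed in auto)
    finally show "br i (br i j) \<bullet> j = nabla i j \<bullet> nabla j i - nabla i j \<bullet> nabla i j
         - nabla (nabla i j) i \<bullet> j + nabla (nabla j i) i \<bullet> j"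
      using torsion_free[OF ij, symmetric]
      by (simp add: inner_diff_left inner_diff_right nabla.diff_left inner_commute)
  qed
  also have "\<dots> = T - N - Q - Q"
    by (simp add: sum.distrib sum_subtractf Q' flip: T_def N_def Q_def)
  finally show ?thesis using 1 Q by (simp add: neg_scal_def field_simps flip: T_def)
qed

text \<open>The inner product of the sum of \<open>nabla j j\<close> with \<open>z\<close> is the
  trace of \<open>ad z\<close>, so unimodularity kills that vector and with it the only curvature
  term not expressible by \<open>T\<close> and \<open>Q\<close>.\<close>

lemma scalar_curvature_unimodular:
  assumes B: "orthonormal_basis V B"
    and unimod: "\<And>x. x \<in> V \<Longrightarrow> (\<Sum>e\<in>B. br x e \<bullet> e) = 0"
  shows "(\<Sum>j\<in>B. nabla j j) = 0" "(\<Sum>i\<in>B. \<Sum>j\<in>B. riem i j j \<bullet> i) = - neg_scal br B"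
proof -
  note BV = orthonormal_basis_in[OF B]
  show n0: "(\<Sum>j\<in>B. nabla j j) = 0"
  proof (rule eqI)
    fix z assume z: "z \<in> V"
    have "(\<Sum>j\<in>B. nabla j j) \<bullet> z = (\<Sum>j\<in>B. br z j \<bullet> j)"
      unfolding inner_sum_left
      by (intro sum.cong refl) (simp add: koszul z BV self antisym[of z])
    then show "(\<Sum>j\<in>B. nabla j j) \<bullet> z = 0 \<bullet> z" using unimod[OF z] by simp
  qed (auto intro: subspace_sum subspace subspace_0)
  define T where "T = (\<Sum>i\<in>B. \<Sum>j\<in>B. nabla i j \<bullet> nabla j i)"
  define Q where "Q = (\<Sum>i\<in>B. \<Sum>j\<in>B. nabla (nabla i j) i \<bullet> j)"
  have Q: "Q = - T" using sum_nabla_nabla[OF B] by (simp add: Q_def T_def)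
  have Q1: "(\<Sum>i\<in>B. \<Sum>j\<in>B. nabla (nabla j i) j \<bullet> i) = Q"
    unfolding Q_def by (rule sum.swap)
  have n1: "(\<Sum>i\<in>B. \<Sum>j\<in>B. nabla i (nabla j j) \<bullet> i) = 0"
    by (simp add: n0 nabla.zero_right flip: inner_sum_left nabla.sum_right)
  have "(\<Sum>i\<in>B. \<Sum>j\<in>B. riem i j j \<bullet> i) =
     (\<Sum>i\<in>B. \<Sum>j\<in>B. nabla i (nabla j j) \<bullet> i + nabla i j \<bullet> nabla j i
        + nabla (nabla i j) i \<bullet> j + nabla (nabla j i) j \<bullet> i)"
  proof (intro sum.cong refl)
    fix i j assume "i \<in> B" "j \<in> B"
    then have ij: "i \<in> V" "j \<in> V" using BV by auto
    have "nabla j (nabla i j) \<bullet> i = - (nabla i j \<bullet> nabla j i)"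
      "nabla (nabla i j) j \<bullet> i = - (nabla (nabla i j) i \<bullet> j)"
      by (rule nabla_skew nabla_skew'; use ij in simp)+
    then show "riem i j j \<bullet> i = nabla i (nabla j j) \<bullet> i + nabla i j \<bullet> nabla j i
        + nabla (nabla i j) i \<bullet> j + nabla (nabla j i) j \<bullet> i"
      using torsion_free[OF ij, symmetric]
      by (simp add: riem_def inner_diff_left nabla.diff_left)
  qed
  also have "\<dots> = T + Q + Q"
    by (simp add: sum.distrib Q1 n1 flip: T_def Q_def)
  finally show "(\<Sum>i\<in>B. \<Sum>j\<in>B. riem i j j \<bullet> i) = - neg_scal br B"
    using Q by (simp add: neg_scal_nabla[OF B] T_def)
qed

end

section \<open>Unimodular Kaehler Lie algebras are scalar flat\<close>

locale kaehler_lie_algebra = metric_lie_algebra V br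
  for V :: "'a::euclidean_space set" and br +
  fixes J :: "'a \<Rightarrow> 'a"
  assumes linear_J: "linear J" and J_in [simp]: "\<And>x. x \<in> V \<Longrightarrow> J x \<in> V"
    and J_J [simp]: "\<And>x. x \<in> V \<Longrightarrow> J (J x) = - x"
    and J_iso: "\<And>x y. x \<in> V \<Longrightarrow> y \<in> V \<Longrightarrow> J x \<bullet> J y = x \<bullet> y"
    and integrable: "\<And>x y. x \<in> V \<Longrightarrow> y \<in> V \<Longrightarrow>
      br (J x) (J y) - br x y - J (br (J x) y + br x (J y)) = 0"
    and d_omega: "\<And>x y z. x \<in> V \<Longrightarrow> y \<in> V \<Longrightarrow> z \<in> V \<Longrightarrow>
      d2 br (fundamental_form J (\<bullet>)) x y z = 0"
begin

lemma J_skew: "x \<in> V \<Longrightarrow> y \<in> V \<Longrightarrow> J x \<bullet> y = - (x \<bullet> J y)"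
  using J_iso[of x "J y"] by simp

lemma J_image: "J ` V = V"
proof -
  have "x \<in> J ` V" if "x \<in> V" for x
    using that subspace linear_neg[OF linear_J, of "J x"]
    by (intro image_eqI[of _ _ "- J x"]) (auto simp: subspace_neg)
  then show ?thesis by auto
qed

text \<open>The complex structure is parallel: the Koszul formula writes the covariant derivative of
  \<open>J\<close> through d\<omega> at \<open>(x, y, z)\<close> and \<open>(x, J y, J z)\<close>
  and the integrability tensor, all of which vanish.\<close>

lemma nabla_J:
  assumes "x \<in> V" "y \<in> V"
  shows "nabla x (J y) = J (nabla x y)"
proof (rule eqI)
  fix z assume "z \<in> V"
  note V = assms this
  have int: "br (J y) z + br y (J z) = - J (br (J y) (J z) - br y z)"
  proof -
    let ?s = "br (J y) z + br y (J z)"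
    have "?s \<in> V" using V by (intro subspace_add[OF subspace] closed) auto
    then have "?s = - J (J ?s)" by simp
    also have "J ?s = br (J y) (J z) - br y z" using integrable[OF V(2,3)] by simp
    finally show ?thesis .
  qed
  have "(br (J y) z + br y (J z)) \<bullet> x = - (J (br (J y) (J z)) \<bullet> x) + J (br y z) \<bullet> x"
    unfolding int by (simp add: linear_diff[OF linear_J] inner_diff_left)
  moreover have "J (br x (J y)) \<bullet> J z = br x (J y) \<bullet> z" "J (br (J z) x) \<bullet> J y = br (J z) x \<bullet> y"
    "J (br x y) \<bullet> z = - (br x y \<bullet> J z)" "J (br z x) \<bullet> y = - (br z x \<bullet> J y)"
    using V by (simp_all add: J_iso J_skew closed)
  ultimately have "nabla x (J y) \<bullet> z + nabla x y \<bullet> J z = 0"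
    using d_omega[OF V] d_omega[OF V(1) J_in[OF V(2)] J_in[OF V(3)]] V
    by (simp add: koszul d2_def fundamental_form_def inner_add_left field_simps)
  then show "nabla x (J y) \<bullet> z = J (nabla x y) \<bullet> z"
    using J_skew[of "nabla x y" z] V by simp
qed (use assms in auto)

lemma riem_J: "x \<in> V \<Longrightarrow> y \<in> V \<Longrightarrow> z \<in> V \<Longrightarrow> riem x y (J z) = J (riem x y z)"
  by (simp add: riem_def nabla_J closed linear_diff[OF linear_J])

lemma riem_in: "x \<in> V \<Longrightarrow> y \<in> V \<Longrightarrow> riem x y z \<in> V"
  by (simp add: riem_def subspace_diff subspace)

text \<open>The double sum of \<open>riem j (J j) i \<bullet> J i\<close> is, up to a factor, the
  trace of the Ricci form. It depends only on the sum of the brackets \<open>br j (J j)\<close>,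
  hence vanishes, while the Bianchi identity makes it minus twice the scalar curvature
  \<open>s\<close>.\<close>

theorem neg_scal_zero:
  assumes B: "orthonormal_basis V B"
    and unimod: "\<And>x. x \<in> V \<Longrightarrow> (\<Sum>e\<in>B. br x e \<bullet> e) = 0"
  shows "neg_scal br B = 0"
proof -
  note BV [simp] = orthonormal_basis_in[OF B]
  note n0 = scalar_curvature_unimodular(1)[OF B unimod]
  interpret J: linear J by (rule linear_J)
  define s where "s = (\<Sum>i\<in>B. \<Sum>j\<in>B. riem i j j \<bullet> i)"
  have s_swap: "(\<Sum>i\<in>B. \<Sum>j\<in>B. riem j i i \<bullet> j) = s"
    unfolding s_def by (rule sum.swap)
  \<comment> \<open>Rotating the basis by \<open>J\<close> and using that \<open>J\<close> is
    parallel reduces this sum to the one that unimodularity annihilates.\<close>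
  have "(\<Sum>j\<in>B. nabla (J j) j) = (\<Sum>j\<in>B. nabla (J (J j)) (J j))"
    by (rule bilinear_trace_isometry[OF _ B linear_J J_image J_iso, symmetric])
      (auto intro!: linearI simp: bilinear_def J.add J.scaleR nabla.add_left nabla.add_right
        nabla.scaleR_left nabla.scaleR_right)
  also have "\<dots> = - J (\<Sum>j\<in>B. nabla j j)"
    by (simp add: nabla_J nabla.minus_left J.sum sum_negf)
  finally have 1: "(\<Sum>j\<in>B. nabla (J j) j) = 0" using n0 J.zero by simp
  have "(\<Sum>j\<in>B. br j (J j)) = (\<Sum>j\<in>B. J (nabla j j) - nabla (J j) j)"
    by (intro sum.cong refl) (simp add: nabla_J flip: torsion_free)
  also have "\<dots> = 0"
    using 1 n0 J.zero by (simp add: sum_subtractf flip: J.sum)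
  finally have brJ: "(\<Sum>j\<in>B. br j (J j)) = 0" .
  \<comment> \<open>Both operators commute with \<open>J\<close>, so by cyclicity the trace of their
    commutator against \<open>J\<close> is zero; only the bracket term of the curvature
    survives.\<close>
  have tr: "(\<Sum>i\<in>B. nabla a (nabla b i) \<bullet> J i) = (\<Sum>i\<in>B. nabla b (nabla a i) \<bullet> J i)"
    if "a \<in> V" "b \<in> V" for a b
  proof -
    have *: "(\<Sum>i\<in>B. nabla c (nabla d i) \<bullet> J i) = - (\<Sum>i\<in>B. nabla c (J (nabla d i)) \<bullet> i)"
      if "c \<in> V" "d \<in> V" for c d
      using that by (simp add: nabla_J J_skew sum_negf)
    have "(\<Sum>i\<in>B. nabla a (J (nabla b i)) \<bullet> i) = (\<Sum>i\<in>B. J (nabla b (nabla a i)) \<bullet> i)"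
      by (rule trace_cyclic[OF B, where f = "nabla a" and g = "\<lambda>i. J (nabla b i)"])
        (auto intro!: linearI simp: J.add J.scaleR nabla.add_right nabla.scaleR_right)
    also have "\<dots> = (\<Sum>i\<in>B. nabla b (J (nabla a i)) \<bullet> i)"
      using that by (simp add: nabla_J)
    finally show ?thesis using that by (simp add: *)
  qed
  have "(\<Sum>i\<in>B. \<Sum>j\<in>B. riem j (J j) i \<bullet> J i) = (\<Sum>j\<in>B. \<Sum>i\<in>B. riem j (J j) i \<bullet> J i)"
    by (rule sum.swap)
  also have "\<dots> = (\<Sum>j\<in>B. \<Sum>i\<in>B. - (nabla (br j (J j)) i \<bullet> J i))"
    by (rule sum.cong)
      (simp_all add: riem_def inner_diff_left sum_subtractf tr[OF BV J_in[OF BV]] sum_negf)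
  also have "\<dots> = (\<Sum>i\<in>B. \<Sum>j\<in>B. - (nabla (br j (J j)) i \<bullet> J i))"
    by (rule sum.swap)
  also have "\<dots> = 0"
    by (simp add: sum_negf brJ nabla.zero_left flip: inner_sum_left nabla.sum_left)
  finally have X: "(\<Sum>i\<in>B. \<Sum>j\<in>B. riem j (J j) i \<bullet> J i) = 0" .
  \<comment> \<open>Rotating the basis turns the pair \<open>J j\<close>, \<open>j\<close> into
    \<open>- j\<close>, \<open>J j\<close>; the outer \<open>J\<close> then cancels by isometry, and
    skew-symmetry of the curvature gives the sign.\<close>
  have Y: "(\<Sum>j\<in>B. riem (J j) i j \<bullet> J i) = (\<Sum>j\<in>B. riem j i i \<bullet> j)" if i: "i \<in> B" for i
  proof -
    have "(\<Sum>j\<in>B. riem (J j) i j \<bullet> J i) = (\<Sum>j\<in>B. riem (J (J j)) i (J j) \<bullet> J i)"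
      by (rule bilinear_trace_isometry[OF _ B linear_J J_image J_iso, symmetric])
        (auto intro!: linearI simp: bilinear_def riem_def J.add J.scaleR nabla.add_left
          nabla.add_right nabla.scaleR_left nabla.scaleR_right br.add_left br.scaleR_left
          inner_diff_left inner_add_left algebra_simps)
    also have "\<dots> = (\<Sum>j\<in>B. riem j i i \<bullet> j)"
    proof (rule sum.cong[OF refl])
      fix j assume j: "j \<in> B"
      have "riem (J (J j)) i (J j) \<bullet> J i = - (J (riem j i j) \<bullet> J i)"
        using i j by (simp add: riem_J riem_def nabla.minus_left nabla.minus_right br.minus_left
            nabla_J closed J.diff inner_diff_left inner_add_left)
      also have "\<dots> = riem j i i \<bullet> j"
        using i j riem_skew[of j i j i] by (simp add: J_iso riem_in)
      finally show "riem (J (J j)) i (J j) \<bullet> J i = riem j i i \<bullet> j" .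
    qed
    finally show ?thesis .
  qed
  have "s = (\<Sum>i\<in>B. \<Sum>j\<in>B. - (riem j (J j) i \<bullet> J i) - riem (J j) i j \<bullet> J i)"
    unfolding s_def
  proof (intro sum.cong refl)
    fix i j assume ij: "i \<in> B" "j \<in> B"
    have "riem i j j \<bullet> i = riem i j (J j) \<bullet> J i"
      using ij by (simp add: riem_J J_iso riem_in)
    also have "\<dots> = - (riem j (J j) i \<bullet> J i) - riem (J j) i j \<bullet> J i"
      using arg_cong[OF bianchi[of i j "J j"], of "\<lambda>v. v \<bullet> J i"] ij
      by (simp add: inner_add_left)
    finally show "riem i j j \<bullet> i = - (riem j (J j) i \<bullet> J i) - riem (J j) i j \<bullet> J i" .
  qed
  also have "\<dots> = - s"
    by (simp add: sum_subtractf sum_negf X Y s_swap)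
  finally show ?thesis
    using scalar_curvature_unimodular(2)[OF B unimod] by (simp add: s_def)
qed

end

section \<open>Solvable Lie algebras have nonpositive scalar curvature\<close>

lemma derived_series_mono: "U \<subseteq> V \<Longrightarrow> derived_series U br n \<subseteq> derived_series V br n"
proof (induction n)
  case (Suc n)
  then show ?case unfolding derived_series.simps by (intro span_mono) blast
qed simp

lemma derived_series_perfect:
  assumes "span {br x y |x y. x \<in> V \<and> y \<in> V} = V"
  shows "derived_series V br n = V"
proof (induction n)
  case (Suc n)
  then show ?case using assms by (simp only: derived_series.simps)
qed simp

text \<open>The complement of \<open>b\<close> contains the derived algebra, hence is a codimension-one ideal.\<close>

lemma solvable_unit_normal:
  assumes "metric_lie_algebra V br" and "derived_series V br n \<subseteq> {0}" and "V \<noteq> {0}"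
  obtains b where "b \<in> V" "b \<bullet> b = 1" "\<And>x y. x \<in> V \<Longrightarrow> y \<in> V \<Longrightarrow> br x y \<bullet> b = 0"
proof -
  interpret metric_lie_algebra V br by fact
  let ?S = "{br x y |x y. x \<in> V \<and> y \<in> V}"
  have V: "span V = V" using subspace by simp
  have "span ?S \<noteq> V"
  proof
    assume "span ?S = V"
    then have "V \<subseteq> {0}" using derived_series_perfect assms(2) by blast
    then show False using assms(3) subspace_0[OF subspace] by blast
  qed
  moreover have "span ?S \<subseteq> V" by (rule span_minimal) (use closed subspace in auto)
  ultimately have "span ?S \<subset> span V" using V by blast
  from orthogonal_to_subspace_exists_gen[OF this]
  obtain a where a: "a \<noteq> 0" "a \<in> V" "\<And>y. y \<in> span ?S \<Longrightarrow> orthogonal a y"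
    unfolding V by blast
  show ?thesis
  proof (rule that[of "(1 / norm a) *\<^sub>R a"])
    show "(1 / norm a) *\<^sub>R a \<in> V" using a subspace by (simp add: subspace_scale)
    show "(1 / norm a) *\<^sub>R a \<bullet> (1 / norm a) *\<^sub>R a = 1"
      using a by (simp add: dot_square_norm power2_eq_square)
    fix x y assume "x \<in> V" "y \<in> V"
    then have "br x y \<in> span ?S" by (blast intro: span_base)
    then have "orthogonal a (br x y)" by (rule a(3))
    then show "br x y \<bullet> (1 / norm a) *\<^sub>R a = 0"
      by (simp add: orthogonal_def inner_commute)
  qed
qed

section \<open>Milnor's reduction to a codimension-one ideal\<close>

locale codim_one_ideal = metric_lie_algebra V br
  for V :: "'a::euclidean_space set" and br +
  fixes b :: 'a and U :: "'a set"
  assumes b_in: "b \<in> V" and b_unit: "b \<bullet> b = 1"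
    and b_perp: "\<And>x y. x \<in> V \<Longrightarrow> y \<in> V \<Longrightarrow> br x y \<bullet> b = 0"
    and U_def: "U = {x \<in> V. x \<bullet> b = 0}"
begin

lemma U_sub: "x \<in> U \<Longrightarrow> x \<in> V" and U_perp: "x \<in> U \<Longrightarrow> x \<bullet> b = 0"
  by (auto simp: U_def)

lemma br_in_U: "x \<in> V \<Longrightarrow> y \<in> V \<Longrightarrow> br x y \<in> U"
  by (simp add: U_def closed b_perp)

sublocale U: metric_lie_algebra U br
proof
  show "subspace U"
    unfolding subspace_def
    using subspace by (auto simp: U_def subspace_0 subspace_add subspace_scale inner_add_left)
qed (use bilin br_in_U self jacobi U_sub in \<open>simp_all\<close>)

lemma decompose:
  assumes "x \<in> V"
  obtains s u where "u \<in> U" "x = s *\<^sub>R b + u"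
proof -
  have "x - (x \<bullet> b) *\<^sub>R b \<in> U"
    using assms b_in subspace
    by (simp add: U_def subspace_diff subspace_scale inner_diff_left b_unit)
  then show ?thesis using that[of "x - (x \<bullet> b) *\<^sub>R b" "x \<bullet> b"] by simp
qed

lemma orthonormal_basis_insert:
  assumes B: "orthonormal_basis U B"
  shows "orthonormal_basis V (insert b B)" "b \<notin> B"
proof -
  have BU: "e \<bullet> b = 0" "e \<in> V" if "e \<in> B" for e
    using orthonormal_basis_in[OF B that] by (simp_all add: U_def)
  show "b \<notin> B" using BU b_unit by force
  have "span (insert b B) \<subseteq> V"
    by (rule span_minimal) (use BU b_in subspace in auto)
  moreover have "V \<subseteq> span (insert b B)"
  proof
    fix x assume "x \<in> V"
    then obtain s u where x: "u \<in> U" "x = s *\<^sub>R b + u" by (rule decompose)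
    have "u \<in> span (insert b B)"
      using x(1) B span_mono[of B "insert b B"] by (auto simp: orthonormal_basis_def)
    then show "x \<in> span (insert b B)"
      unfolding x(2) by (intro span_add span_scale) (auto intro: span_base)
  qed
  ultimately show "orthonormal_basis V (insert b B)"
    using B BU b_unit
    by (auto simp: orthonormal_basis_def pairwise_insert orthogonal_def norm_eq_1 inner_commute)
qed

text \<open>The new nonzero terms contribute half of \<open>P + R\<close>, where \<open>P\<close> is
  the squared norm of \<open>ad b\<close> on \<open>U\<close> and \<open>R\<close> is the trace of
  its square; this is a quarter of the squared norm of \<open>ad b\<close> plus its
  transpose.\<close>

lemma neg_scal_insert:
  assumes B: "orthonormal_basis U B"
  shows "neg_scal br (insert b B) =
    neg_scal br B + (\<Sum>j\<in>B. \<Sum>k\<in>B. (br b j \<bullet> k + br b k \<bullet> j)\<^sup>2) / 4"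
proof -
  note fin [simp] = orthonormal_basis_finite[OF B]
  note nb [simp] = orthonormal_basis_insert(2)[OF B]
  note BU = orthonormal_basis_in[OF B]
  note BV = U_sub[OF BU]
  define P where "P = (\<Sum>j\<in>B. br b j \<bullet> br b j)"
  define R where "R = (\<Sum>j\<in>B. br b (br b j) \<bullet> j)"
  have lin: "linear (\<lambda>x. br b x \<bullet> j)" for j
    by (rule linearI) (simp_all add: br.add_right br.scaleR_right inner_add_left)
  have P: "P = (\<Sum>j\<in>B. \<Sum>k\<in>B. (br b j \<bullet> k)\<^sup>2)"
    unfolding P_def
  proof (rule sum.cong[OF refl])
    fix j assume "j \<in> B"
    then have "br b j \<in> U" by (simp add: br_in_U b_in BV)
    from orthonormal_basis_inner_sum[OF B this, of "br b j"]
    show "br b j \<bullet> br b j = (\<Sum>k\<in>B. (br b j \<bullet> k)\<^sup>2)"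
      by (simp add: power2_eq_square inner_commute)
  qed
  have P': "P = (\<Sum>j\<in>B. \<Sum>k\<in>B. (br b k \<bullet> j)\<^sup>2)"
    unfolding P by (rule sum.swap)
  have R: "R = (\<Sum>j\<in>B. \<Sum>k\<in>B. (br b j \<bullet> k) * (br b k \<bullet> j))"
    unfolding R_def
  proof (rule sum.cong[OF refl])
    fix j assume "j \<in> B"
    then have "br b j \<in> U" by (simp add: br_in_U b_in BV)
    from orthonormal_basis_linear_expand[OF B this lin, of j]
    show "br b (br b j) \<bullet> j = (\<Sum>k\<in>B. (br b j \<bullet> k) * (br b k \<bullet> j))" by simp
  qed
  have "(\<Sum>j\<in>B. \<Sum>k\<in>B. (br b j \<bullet> k + br b k \<bullet> j)\<^sup>2) =
     (\<Sum>j\<in>B. \<Sum>k\<in>B. (br b j \<bullet> k)\<^sup>2 + (br b k \<bullet> j)\<^sup>2 + 2 * ((br b j \<bullet> k) * (br b k \<bullet> j)))"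
    by (intro sum.cong refl) (simp add: power2_sum)
  also have "\<dots> = 2 * P + 2 * R"
    by (simp add: sum.distrib flip: P P' R sum_distrib_left)
  finally have S: "(\<Sum>j\<in>B. \<Sum>k\<in>B. (br b j \<bullet> k + br b k \<bullet> j)\<^sup>2) = 2 * P + 2 * R" .
  have 1: "(\<Sum>i\<in>B. br i b \<bullet> br i b) = P"
    unfolding P_def by (intro sum.cong refl) (simp add: antisym[OF b_in BV])
  have 2: "(\<Sum>i\<in>B. br i (br i b) \<bullet> b) = 0"
    by (intro sum.neutral ballI b_perp BV closed b_in)
  show ?thesis
    unfolding neg_scal_def S
    by (simp add: sum.distrib self b_in br.zero_right 1 2 add_divide_distrib flip: P_def R_def)
qed

lemma neg_scal_insert_ge:
  assumes B: "orthonormal_basis U B"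
  shows "neg_scal br B \<le> neg_scal br (insert b B)"
  unfolding neg_scal_insert[OF B] by (simp add: sum_nonneg)

text \<open>The excess is a sum of squares, so each matrix entry of the symmetric part of
  \<open>ad b\<close> vanishes; linearity in each slot extends this from \<open>B\<close> to
  \<open>U\<close>.\<close>

lemma skew_if_neg_scal_eq:
  assumes B: "orthonormal_basis U B" and eq: "neg_scal br (insert b B) = neg_scal br B"
    and xy: "x \<in> U" "y \<in> U"
  shows "br b x \<bullet> y + br b y \<bullet> x = 0"
proof -
  note fin [simp] = orthonormal_basis_finite[OF B]
  have "(\<Sum>j\<in>B. \<Sum>k\<in>B. (br b j \<bullet> k + br b k \<bullet> j)\<^sup>2) = 0"
    using eq neg_scal_insert[OF B] by simp
  then have 0: "br b j \<bullet> k + br b k \<bullet> j = 0" if "j \<in> B" "k \<in> B" for j k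
    using that by (simp add: sum_nonneg_eq_0_iff sum_nonneg)
  have lin: "linear (\<lambda>x. br b x \<bullet> y + br b y \<bullet> x)" for y
    by (rule linearI)
      (simp_all add: br.add_right br.scaleR_right inner_add_left inner_add_right algebra_simps)
  have 1: "br b x \<bullet> y + br b y \<bullet> x = 0" if "y \<in> B" "x \<in> U" for x y
    using orthonormal_basis_linear_expand[OF B that(2) lin, of y] 0[OF _ that(1)] by simp
  show ?thesis
    using orthonormal_basis_linear_expand[OF B xy(1) lin, of y] 1[OF _ xy(2)]
    by (simp add: add.commute)
qed

text \<open>Skew-symmetry of \<open>ad b\<close> makes \<open>b\<close> parallel, makes
  \<open>nabla b\<close> equal to \<open>ad b\<close> on \<open>U\<close>, and makes the connection
  of \<open>V\<close> restrict to that of \<open>U\<close>. The only new curvature is then that of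
  \<open>b\<close> with a vector of \<open>U\<close>.\<close>

lemma flat_extension:
  assumes skew: "\<And>x y. x \<in> U \<Longrightarrow> y \<in> U \<Longrightarrow> br b x \<bullet> y + br b y \<bullet> x = 0"
    and flat: "flat_metric U br (\<bullet>)"
  shows "flat_metric V br (\<bullet>)"
proof -
  have bU: "br b x \<in> U" if "x \<in> U" for x using that by (simp add: br_in_U b_in U_sub)
  have bb: "br b b = 0" by (simp add: self b_in)
  have xb: "br x b = - br b x" if "x \<in> U" for x
    using that by (intro antisym b_in U_sub)
  have n1: "nabla x y = U.nabla x y" if xy: "x \<in> U" "y \<in> U" for x y
  proof (rule nabla_unique)
    show "U.nabla x y \<in> V" using U.nabla_in by (rule U_sub)
    fix z assume "z \<in> V"
    then obtain s u where z: "u \<in> U" "z = s *\<^sub>R b + u" by (rule decompose)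
    have "U.nabla x y \<bullet> b = 0" by (simp add: U_perp)
    then show "U.nabla x y \<bullet> z = (br x y \<bullet> z - br y z \<bullet> x + br z x \<bullet> y) / 2"
      using z xy eq_neg_iff_add_eq_0[THEN iffD2, OF skew[OF xy]] b_perp[OF U_sub[OF xy(1)] U_sub[OF xy(2)]]
      by (simp add: inner_add_right br.add_left br.add_right br.scaleR_left br.scaleR_right
          inner_add_left inner_diff_left U.koszul xb algebra_simps)
  qed
  have n2: "nabla b x = br b x" if x: "x \<in> U" for x
  proof (rule nabla_unique)
    show "br b x \<in> V" by (simp add: closed b_in U_sub x)
    fix z assume "z \<in> V"
    then obtain s u where z: "u \<in> U" "z = s *\<^sub>R b + u" by (rule decompose)
    show "br b x \<bullet> z = (br b x \<bullet> z - br x z \<bullet> b + br z b \<bullet> x) / 2"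
      using z x skew[OF x z(1)] b_perp[OF b_in U_sub[OF x]] b_perp[OF U_sub[OF x] U_sub[OF z(1)]]
        b_perp[OF U_sub[OF x] b_in]
      by (simp add: inner_add_right br.add_left br.add_right br.scaleR_left br.scaleR_right
          inner_add_left inner_diff_left xb bb)
  qed
  have n3: "nabla x b = 0" if x: "x \<in> V" for x
  proof (rule nabla_unique)
    show "0 \<in> V" by (simp add: subspace_0 subspace)
    fix z assume "z \<in> V"
    then obtain s u where z: "u \<in> U" "z = s *\<^sub>R b + u" by (rule decompose)
    obtain t v where x': "v \<in> U" "x = t *\<^sub>R b + v" using x by (rule decompose)
    show "0 \<bullet> z = (br x b \<bullet> z - br b z \<bullet> x + br z x \<bullet> b) / 2"
      using z x x' skew[OF x'(1) z(1)] b_perp \<open>z \<in> V\<close> b_in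
      by (simp add: inner_add_right br.add_left br.add_right br.scaleR_left br.scaleR_right
          inner_add_left inner_diff_left xb bb br_in_U U_perp bU U.closed)
  qed
  have R1: "riem x y z = 0" if "x \<in> U" "y \<in> U" "z \<in> U" for x y z
  proof -
    have "riem x y z = U.riem x y z"
      using that by (simp add: riem_def U.riem_def n1 U.closed)
    then show ?thesis using flat that by (simp add: U.flat_iff)
  qed
  have R2: "riem b x z = 0" if xz: "x \<in> U" "z \<in> U" for x z
  proof -
    \<comment> \<open>A skew-symmetric derivation preserves both bracket and metric, hence also the
      connection that the Koszul formula builds from them.\<close>
    have "br b (nabla x z) = nabla (br b x) z + nabla x (br b z)"
    proof (rule U.eqI)
      show "br b (nabla x z) \<in> U" "nabla (br b x) z + nabla x (br b z) \<in> U"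
        using xz by (simp_all add: n1 bU subspace_add[OF U.subspace])
      fix w assume w: "w \<in> U"
      have der: "br b (br p q) = br (br b p) q + br p (br b q)" if "p \<in> U" "q \<in> U" for p q
        using jacobi[OF b_in U_sub[OF that(1)] U_sub[OF that(2)]]
          antisym[OF b_in U_sub[OF that(2)]]
          antisym[OF closed[OF b_in U_sub[OF that(1)]] U_sub[OF that(2)]]
        by (simp add: br.minus_right algebra_simps)
      have sk: "br b p \<bullet> q = - (p \<bullet> br b q)" if "p \<in> U" "q \<in> U" for p q
        using skew[OF that] by (simp add: inner_commute)
      have a: "br p q \<bullet> br b r = - (br (br b p) q \<bullet> r) - br p (br b q) \<bullet> r"
        if "p \<in> U" "q \<in> U" "r \<in> U" for p q r
        using sk[of "br p q" r] der[of p q] that by (simp add: U.closed inner_add_left)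
      show "br b (nabla x z) \<bullet> w = (nabla (br b x) z + nabla x (br b z)) \<bullet> w"
        using a[OF xz w] a[OF xz(2) w xz(1)] a[OF w xz]
          sk[of "nabla x z" w] xz w
        by (simp add: n1 U.koszul bU inner_add_left field_simps)
    qed
    then show ?thesis using xz by (simp add: riem_def n2 n1 bU)
  qed
  have R3: "riem x b z = 0" if "x \<in> U" "z \<in> U" for x z
    using R2[OF that] riem_antisym[of b x z] that by (simp add: b_in U_sub)
  have R4: "riem b b z = 0" for z by (simp add: riem_def bb nabla.zero_left)
  have R5: "riem x y b = 0" if "x \<in> V" "y \<in> V" for x y
    using that by (simp add: riem_def n3 closed nabla.zero_right)
  show ?thesis
    unfolding flat_iff
  proof (intro ballI)
    fix x y z assume xyz: "x \<in> V" "y \<in> V" "z \<in> V"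
    obtain s x' where x: "x' \<in> U" "x = s *\<^sub>R b + x'" using xyz(1) by (rule decompose)
    obtain t y' where y: "y' \<in> U" "y = t *\<^sub>R b + y'" using xyz(2) by (rule decompose)
    obtain r z' where z: "z' \<in> U" "z = r *\<^sub>R b + z'" using xyz(3) by (rule decompose)
    have "riem x y z = riem x y z'"
      using R5[OF xyz(1,2)] by (simp add: z(2) riem_right)
    also have "\<dots> = 0"
      using x(1) y(1) z(1) by (simp add: x(2) y(2) riem_left riem_middle R1 R2 R3 R4)
    finally show "riem x y z = 0" .
  qed
qed

end

text \<open>Induction on the dimension: \<open>neg_scal\<close> of the ideal and the added square
  are both nonnegative, so if their sum is zero the ideal is flat and \<open>ad b\<close> is skew.
  Inclusion in \<open>{0}\<close> passes to the ideal by monotonicity of the derived series.\<close>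

theorem solvable_neg_scal:
  assumes "metric_lie_algebra V br" and "derived_series V br n \<subseteq> {0}"
  shows "\<exists>B. orthonormal_basis V B \<and> 0 \<le> neg_scal br B \<and>
    (neg_scal br B = 0 \<longrightarrow> flat_metric V br (\<bullet>))"
  using assms
proof (induction "dim V" arbitrary: V rule: less_induct)
  case less
  interpret metric_lie_algebra V br by fact
  show ?case
  proof (cases "V = {0}")
    case True
    then have "orthonormal_basis V {}" "neg_scal br {} = 0"
      by (auto simp: orthonormal_basis_def neg_scal_def)
    moreover have "flat_metric V br (\<bullet>)"
    proof -
      have "nabla x y = 0" for x y using nabla_in[of x y] True by blast
      then show ?thesis by (simp add: flat_iff riem_def)
    qed
    ultimately show ?thesis by fastforce
  next
    case False
    then obtain b where b: "b \<in> V" "b \<bullet> b = 1" "\<And>x y. x \<in> V \<Longrightarrow> y \<in> V \<Longrightarrow> br x y \<bullet> b = 0"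
      using solvable_unit_normal[OF less.prems] by metis
    define U where "U = {x \<in> V. x \<bullet> b = 0}"
    interpret codim_one_ideal V br b U
      by unfold_locales (use b U_def in auto)
    have "U \<subset> V" using b U_perp[of b] U_sub by force
    then have "dim U < dim V"
      using dim_psubset[of U V] subspace U.subspace by (simp add: span_eq_iff[THEN iffD2])
    moreover have "derived_series U br n \<subseteq> {0}"
      using derived_series_mono[of U V br n] \<open>U \<subset> V\<close> less.prems(2) by blast
    ultimately obtain B where B: "orthonormal_basis U B" "0 \<le> neg_scal br B"
      "neg_scal br B = 0 \<longrightarrow> flat_metric U br (\<bullet>)"
      using less.hyps U.metric_lie_algebra_axioms by blast
    have "flat_metric V br (\<bullet>)" if "neg_scal br (insert b B) = 0"
    proof -
      have "neg_scal br B = 0" using that B(2) neg_scal_insert_ge[OF B(1)] by simp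
      then show ?thesis
        using flat_extension[OF skew_if_neg_scal_eq[OF B(1)]] that B(3) by simp
    qed
    then show ?thesis
      using B neg_scal_insert_ge[OF B(1)] orthonormal_basis_insert(1)[OF B(1)] by force
  qed
qed

section \<open>Skew-symmetric inner derivations of solvable Lie algebras\<close>

lemma orthogonal_projection:
  fixes S :: "'a::euclidean_space set"
  assumes "subspace S"
  obtains p :: "'a \<Rightarrow> 'a" where "linear p" "\<And>x. p x \<in> S" "\<And>x y. y \<in> S \<Longrightarrow> (x - p x) \<bullet> y = 0"
proof -
  obtain C where C: "orthonormal_basis S C" using orthonormal_basis_exists assms by blast
  define p where "p x = (\<Sum>c\<in>C. (x \<bullet> c) *\<^sub>R c)" for x
  show ?thesis
  proof
    show "linear p"
      by (rule linearI)
        (simp_all add: p_def inner_add_left scaleR_left_distrib sum.distrib scaleR_sum_right)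
    show "p x \<in> S" for x
      unfolding p_def by (intro subspace_sum assms subspace_scale orthonormal_basis_in[OF C])
    show "(x - p x) \<bullet> y = 0" if "y \<in> S" for x y
    proof -
      have "p x \<bullet> y = (\<Sum>c\<in>C. (y \<bullet> c) * (c \<bullet> x))"
        unfolding p_def inner_sum_left by (simp add: inner_commute mult.commute)
      then show ?thesis
        using orthonormal_basis_inner_sum[OF C that, of x]
        by (simp add: inner_diff_left inner_diff_right inner_commute)
    qed
  qed
qed

context metric_lie_algebra
begin

section \<open>The derived series as a chain of ideals\<close>

abbreviation "D \<equiv> derived_series V br"

lemma subspace_D: "subspace (D n)"
  by (cases n) (simp_all add: subspace)

lemma D_bracket: "x \<in> D n \<Longrightarrow> y \<in> D n \<Longrightarrow> br x y \<in> D (Suc n)"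
  unfolding derived_series.simps by (intro span_base) blast

text \<open>\<open>ad x\<close> is a derivation, so it preserves every term of the series.
  Membership in \<open>V\<close> is carried through the induction because the Jacobi identity is
  available only there.\<close>

lemma D_ideal: "x \<in> V \<Longrightarrow> y \<in> D n \<Longrightarrow> y \<in> V \<and> br x y \<in> D n"
proof (induction n arbitrary: x y)
  case (Suc n)
  have gen: "p \<in> V \<and> q \<in> V \<and> br p q \<in> V \<and> br x (br p q) \<in> D (Suc n)"
    if "x \<in> V" "p \<in> D n" "q \<in> D n" for x p q
  proof -
    have pq: "p \<in> V" "q \<in> V" using Suc.IH that by blast+
    have "br x (br p q) = br (br x p) q + br p (br x q)"
      using jacobi[OF \<open>x \<in> V\<close> pq] antisym[OF \<open>x \<in> V\<close> pq(2)]
        antisym[OF closed[OF \<open>x \<in> V\<close> pq(1)] pq(2)]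
      by (simp add: br.minus_right algebra_simps)
    moreover have "br (br x p) q \<in> D (Suc n)" "br p (br x q) \<in> D (Suc n)"
      using D_bracket Suc.IH that by blast+
    ultimately show ?thesis
      using pq closed subspace_add[OF subspace_D[of "Suc n"]] by metis
  qed
  have "y \<in> span {br p q |p q. p \<in> D n \<and> q \<in> D n}" using Suc.prems by simp
  then show ?case
  proof (induction rule: span_induct_alt)
    case base
    show ?case by (simp add: br.zero_right subspace_0 subspace subspace_D del: derived_series.simps)
  next
    case (step c u v)
    then have "u \<in> V \<and> br x u \<in> D (Suc n)" using gen Suc.prems(1) by blast
    then show ?case
      using step
      by (simp add: br.add_right br.scaleR_right subspace_add subspace_scale subspace subspace_D
          del: derived_series.simps)
  qed
qed (simp add: closed)

lemma D_sub: "x \<in> D n \<Longrightarrow> x \<in> V"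
  using D_ideal[of 0 x n] subspace_0[OF subspace] by blast

lemma D_Suc_sub: "x \<in> D (Suc n) \<Longrightarrow> x \<in> D n"
proof -
  assume "x \<in> D (Suc n)"
  moreover have "span {br p q |p q. p \<in> D n \<and> q \<in> D n} \<subseteq> D n"
    using D_ideal D_sub by (intro span_minimal subspace_D) blast
  ultimately show ?thesis by auto
qed

text \<open>
  If \<open>ad \<xi>\<close> maps into the ideal \<open>D n\<close>, then on \<open>D n / D (Suc n)\<close> it commutes with the adjoint
  action.  As \<open>\<xi>\<close> is a sum of brackets, the trace of \<open>(ad \<xi>)\<^sup>2\<close> on this quotient is then a sum of
  traces of commutators, so that the skew-symmetric \<open>ad \<xi>\<close> vanishes there.
\<close>

lemma skew_ad_step:
  assumes V: "V = UNIV" and skew: "\<And>x y. br \<xi> x \<bullet> y = - (x \<bullet> br \<xi> y)"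
    and \<xi>: "\<xi> \<in> span {br x y |x y. x \<in> V \<and> y \<in> V}" and F: "\<And>x. br \<xi> x \<in> D n"
  shows "br \<xi> x \<in> D (Suc n)"
proof -
  \<comment> \<open>The orthogonal complement of \<open>D (Suc n)\<close> in \<open>D n\<close>
    models the quotient; \<open>P\<close> below is the corresponding projection, killing
    \<open>D (Suc n)\<close>.\<close>
  define M where "M = {x \<in> D n. \<forall>d\<in>D (Suc n). x \<bullet> d = 0}"
  have "subspace M"
    unfolding subspace_def M_def using subspace_D[of n]
    by (auto simp: subspace_0 subspace_add subspace_scale inner_add_left simp del: derived_series.simps)
  then obtain B where B: "orthonormal_basis M B" using orthonormal_basis_exists by blast
  obtain q where q: "linear q" "\<And>x. q x \<in> D (Suc n)"
    "\<And>x y. y \<in> D (Suc n) \<Longrightarrow> (x - q x) \<bullet> y = 0"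
    using orthogonal_projection[OF subspace_D] by metis
  define P where "P x = x - q x" for x
  have linP: "linear P" unfolding P_def using q(1) by (intro linear_compose_sub linear_ident)
  interpret P: linear P by (rule linP)
  have P_split: "P (br y x) = P (br y (P x)) + P (br y (q x))" for x y
  proof -
    have "br y x = br y (P x) + br y (q x)"
      unfolding br.add_right[symmetric] by (simp add: P_def)
    then show ?thesis by (simp only: P.add)
  qed
  have PM: "P x \<in> M" if "x \<in> D n" for x
    using that q D_Suc_sub[OF q(2)]
    by (auto simp: M_def P_def subspace_diff[OF subspace_D] simp del: derived_series.simps)
  have P0: "P d = 0" if "d \<in> D (Suc n)" for d
  proof -
    have "d - q d \<in> D (Suc n)" using that q(2) by (intro subspace_diff subspace_D)
    then have "(d - q d) \<bullet> (d - q d) = 0" using q(3) by blast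
    then show ?thesis by (simp add: P_def)
  qed
  have MD: "m \<in> D n" if "m \<in> M" for m using that by (simp add: M_def)
  have ideal: "br y x \<in> D m" if "x \<in> D m" for x y m using D_ideal that V by blast
  have FM: "br \<xi> m \<in> M" if "m \<in> M" for m
    using that F ideal[of _ "Suc n" \<xi>] by (auto simp: M_def skew simp del: derived_series.simps)
  \<comment> \<open>The adjoint action on the quotient, transported to \<open>M\<close>.\<close>
  define Y where "Y y x = P (br y x)" for y x
  have linY: "linear (Y y)" for y
    by (rule linearI) (simp_all add: Y_def br.add_right br.scaleR_right P.add P.scaleR)
  have YM: "Y y m \<in> M" if "m \<in> M" for y m
    unfolding Y_def by (intro PM ideal MD that)
  have FY: "br \<xi> (Y y m) = Y y (br \<xi> m)" if m: "m \<in> M" for y m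
  proof -
    define u where "u = br y m"
    have u: "u \<in> D n" unfolding u_def by (intro ideal MD m)
    have "P (br \<xi> u) = P (br \<xi> (P u)) + P (br \<xi> (q u))" by (rule P_split)
    also have "P (br \<xi> (q u)) = 0" by (intro P0 ideal q)
    also have "P (br \<xi> (P u)) = br \<xi> (P u)"
    proof -
      have "br \<xi> (P u) \<in> M" by (intro FM PM u)
      moreover have "q x = 0" if "x \<in> M" for x
      proof -
        have "(x - q x) \<bullet> q x = 0" "x \<bullet> q x = 0" using q that by (auto simp: M_def)
        then show ?thesis by (simp add: inner_diff_left)
      qed
      ultimately show ?thesis by (simp add: P_def)
    qed
    finally have 1: "P (br \<xi> u) = br \<xi> (P u)" by simp
    have "br \<xi> u = br (br \<xi> y) m + br y (br \<xi> m)"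
      using jacobi[of \<xi> y m] antisym[of \<xi> m] antisym[of "br \<xi> y" m] V
      by (simp add: u_def br.minus_right algebra_simps)
    \<comment> \<open>This is the defect of commutation: \<open>br \<xi> y\<close> and
      \<open>m\<close> both lie in \<open>D n\<close>, so their bracket is zero in the
      quotient.\<close>
    moreover have "P (br (br \<xi> y) m) = 0" by (intro P0 D_bracket F MD m)
    ultimately show ?thesis using 1 by (simp add: Y_def u_def P.add)
  qed
  have Ycomm: "Y (br y z) m = Y y (Y z m) - Y z (Y y m)" if m: "m \<in> M" for y z m
  proof -
    have *: "Y a (Y c m) = P (br a (br c m))" for a c
    proof -
      have "P (br a (br c m)) = P (br a (P (br c m))) + P (br a (q (br c m)))" by (rule P_split)
      moreover have "P (br a (q (br c m))) = 0" by (intro P0 ideal q)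
      ultimately show ?thesis by (simp add: Y_def)
    qed
    have "br (br y z) m = br y (br z m) - br z (br y m)"
      using jacobi[of y z m] antisym[of y m] antisym[of "br y z" m] V
      by (simp add: br.minus_right algebra_simps)
    then show ?thesis unfolding * by (simp add: Y_def P.diff)
  qed
  \<comment> \<open>A linear functional that vanishes on brackets, hence at \<xi>, where its value
    is minus the squared norm of \<open>ad \<xi>\<close> on \<open>M\<close>.\<close>
  define \<phi> where "\<phi> w = (\<Sum>e\<in>B. br \<xi> (Y w e) \<bullet> e)" for w
  have lin\<phi>: "linear \<phi>"
    by (rule linearI) (simp_all add: \<phi>_def Y_def br.add_left br.scaleR_left P.add P.scaleR
        br.add_right br.scaleR_right inner_add_left sum.distrib sum_distrib_left)
  have "\<phi> (br y z) = 0" for y z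
  proof -
    note BM = orthonormal_basis_in[OF B]
    have "(\<Sum>e\<in>B. br \<xi> (Y y (Y z e)) \<bullet> e) = (\<Sum>e\<in>B. Y y (br \<xi> (Y z e)) \<bullet> e)"
      by (simp add: FY YM BM)
    also have "\<dots> = (\<Sum>e\<in>B. br \<xi> (Y z (Y y e)) \<bullet> e)"
      by (rule trace_cyclic[OF B linY _ , where g = "\<lambda>e. br \<xi> (Y z e)"])
        (use YM FM in \<open>auto intro!: linearI simp: linear_add[OF linY] linear_cmul[OF linY]
          br.add_right br.scaleR_right\<close>)
    finally show ?thesis
      by (simp add: \<phi>_def Ycomm BM br.diff_right inner_diff_left sum_subtractf)
  qed
  then have "\<phi> \<xi> = 0"
    using linear_eq_0_on_span[OF lin\<phi> _ \<xi>] by blast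
  moreover have "\<phi> \<xi> = (\<Sum>e\<in>B. - (br \<xi> e \<bullet> br \<xi> e))"
    unfolding \<phi>_def
  proof (rule sum.cong[OF refl])
    fix e assume "e \<in> B"
    then have e: "e \<in> M" by (rule orthonormal_basis_in[OF B])
    have "br \<xi> (Y \<xi> e) \<bullet> e = - (P (br \<xi> e) \<bullet> br \<xi> e)" by (simp add: Y_def skew)
    also have "P (br \<xi> e) \<bullet> br \<xi> e = br \<xi> e \<bullet> br \<xi> e"
    proof -
      have "br \<xi> e \<bullet> q (br \<xi> e) = 0" using q(2) FM[OF e] unfolding M_def by blast
      then show ?thesis by (simp add: P_def inner_diff_left inner_commute[of "q _"])
    qed
    finally show "br \<xi> (Y \<xi> e) \<bullet> e = - (br \<xi> e \<bullet> br \<xi> e)" .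
  qed
  ultimately have FB: "br \<xi> e = 0" if "e \<in> B" for e
    using that orthonormal_basis_finite[OF B] by (simp add: sum_negf sum_nonneg_eq_0_iff)
  have FM0: "br \<xi> m = 0" if "m \<in> M" for m
  proof -
    have "linear (br \<xi>)" by (rule linearI) (simp_all add: br.add_right br.scaleR_right)
    from orthonormal_basis_linear_expand[OF B that this] show ?thesis by (simp add: FB)
  qed
  have FD: "br \<xi> u \<in> D (Suc n)" if "u \<in> D n" for u
  proof -
    have "br \<xi> u = br \<xi> (P u) + br \<xi> (q u)" by (simp add: P_def flip: br.add_right)
    then show ?thesis using FM0[OF PM[OF that]] ideal[OF q(2)] by simp
  qed
  have lin: "linear (br \<xi>)" by (rule linearI) (simp_all add: br.add_right br.scaleR_right)
  \<comment> \<open>The kernel of a skew map is the orthogonal complement of its range, so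
    \<open>x\<close> may be replaced by its projection to the range, which lies in
    \<open>D n\<close>; this extends the conclusion from \<open>D n\<close> to all
    \<open>x\<close>.\<close>
  have "subspace (range (br \<xi>))" using linear_subspace_image[OF lin subspace_UNIV] .
  then obtain p where p: "\<And>x. p x \<in> range (br \<xi>)" "\<And>x y. y \<in> range (br \<xi>) \<Longrightarrow> (x - p x) \<bullet> y = 0"
    using orthogonal_projection by metis
  have "br \<xi> (x - p x) \<bullet> br \<xi> (x - p x) = 0"
    using p(2) by (subst skew) simp
  then have "br \<xi> x = br \<xi> (p x)" by (simp add: br.diff_right)
  moreover have "p x \<in> D n" using p(1)[of x] F by (auto simp del: derived_series.simps)
  ultimately show ?thesis using FD by simp
qed

theorem skew_ad_zero:
  assumes V: "V = UNIV" and solv: "D n \<subseteq> {0}"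
    and skew: "\<And>x y. br \<xi> x \<bullet> y = - (x \<bullet> br \<xi> y)"
    and \<xi>: "\<xi> \<in> span {br x y |x y. x \<in> V \<and> y \<in> V}"
  shows "br \<xi> x = 0"
proof -
  have "br \<xi> x \<in> D k" for k x
  proof (induction k arbitrary: x)
    case 0
    show ?case using V by simp
  next
    case (Suc k)
    show ?case by (rule skew_ad_step[OF V skew \<xi> Suc])
  qed
  then show ?thesis using solv by blast
qed

end

section \<open>Vaisman structures\<close>

locale unimodular_solvable_vaisman =
  fixes br :: "'a::euclidean_space \<Rightarrow> 'a \<Rightarrow> 'a" and J :: "'a \<Rightarrow> 'a"
    and \<theta> :: "'a \<Rightarrow> real" and A :: 'a
  assumes lie: "lie_algebra UNIV br" and solvable: "lie_solvable UNIV br"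
    and unimodular: "unimodular br" and vaisman: "vaisman_structure UNIV br J (\<bullet>) \<theta>"
    and A_orth: "A \<in> orthogonal_comp {x. \<theta> x = 0}" and \<theta>_A: "\<theta> A = 1" and norm_A: "norm A = 1"
begin

sublocale metric_lie_algebra UNIV br
  using lie
  by unfold_locales
    (auto simp: lie_algebra_def bilinear_on_def linear_on_def bilinear_def intro!: linearI)

lemma lck: "lck_structure UNIV br J (\<bullet>) \<theta>" and herm: "hermitian_structure UNIV br J (\<bullet>)"
  using vaisman by (auto simp: vaisman_structure_def lck_structure_def)

lemma J_J [simp]: "J (J x) = - x" and J_iso [simp]: "J x \<bullet> J y = x \<bullet> y"
  and integrable: "br (J x) (J y) - br x y - J (br (J x) y + br x (J y)) = 0"
  and linear_J: "linear J"
  using herm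
  by (auto simp: hermitian_structure_def complex_structure_def endomorphism_on_def linear_on_def
      intro!: linearI)

sublocale J: linear J by (rule linear_J)

lemma J_skew: "J x \<bullet> y = - (x \<bullet> J y)"
  using J_iso[of x "J y"] by simp

lemma A_A [simp]: "A \<bullet> A = 1"
  using norm_A by (simp add: norm_eq_1)

text \<open>The vector \<open>x - \<theta> x *\<^sub>R A\<close> lies in the kernel and so is
  orthogonal to \<open>A\<close>; as \<open>A\<close> is a unit vector, it is the metric dual of
  \<theta>.\<close>

lemma \<theta>_eq: "\<theta> x = x \<bullet> A"
proof -
  have "linear_on UNIV \<theta>" using lck by (simp add: lck_structure_def)
  then have "\<theta> (y + z) = \<theta> y + \<theta> z" "\<theta> (c *\<^sub>R z) = c * \<theta> z" for y z c
    by (auto simp: linear_on_def)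
  from this(1)[of x "(- \<theta> x) *\<^sub>R A"] this(2)[of "- \<theta> x" A]
  have "\<theta> (x + (- \<theta> x) *\<^sub>R A) = 0" by (simp add: \<theta>_A)
  then have "(x + (- \<theta> x) *\<^sub>R A) \<bullet> A = 0"
    using A_orth by (simp add: orthogonal_comp_def orthogonal_def)
  then show ?thesis by (simp add: inner_add_left inner_diff_left)
qed

lemma bracket_A [simp]: "br x y \<bullet> A = 0"
  using lck by (simp add: lck_structure_def d1_def \<theta>_eq)

lemma d_omega:
  "- (J (br x y) \<bullet> z) - J (br y z) \<bullet> x - J (br z x) \<bullet> y =
     (x \<bullet> A) * (J y \<bullet> z) + (y \<bullet> A) * (J z \<bullet> x) + (z \<bullet> A) * (J x \<bullet> y)"
  using lck
  by (simp add: lck_structure_def d2_def wedge12_def fundamental_form_def \<theta>_eq)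

text \<open>As \<theta> is parallel, the Koszul formula for \<open>nabla x y\<close> against
  \<open>A\<close> gives zero; its term \<open>br x y \<bullet> A\<close> vanishes because \<theta>
  is closed, and the rest is skew-symmetry.\<close>

lemma A_killing: "br A x \<bullet> y = - (x \<bullet> br A y)"
proof -
  have "nabla x y \<bullet> A = 0"
    using vaisman by (simp add: vaisman_structure_def cov_deriv1_def \<theta>_eq nabla_def)
  then show ?thesis
    using koszul[of A x y] antisym[of A y] bracket_A[of x y] by (simp add: inner_commute)
qed

section \<open>The vector \<open>J A\<close>, its adjoint action and the compatibility of
  \<open>ad A\<close> with \<open>J\<close>\<close>

definition \<xi> :: 'a where "\<xi> = J A"

lemma \<xi>_A [simp]: "\<xi> \<bullet> A = 0" "A \<bullet> \<xi> = 0" and \<xi>_\<xi> [simp]: "\<xi> \<bullet> \<xi> = 1"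
  and J_\<xi> [simp]: "J \<xi> = - A"
  using J_skew[of A A] by (simp_all add: \<xi>_def inner_commute)

lemma J_inner_\<xi> [simp]: "J x \<bullet> \<xi> = x \<bullet> A" and J_inner_A [simp]: "J x \<bullet> A = - (x \<bullet> \<xi>)"
  by (simp_all add: \<xi>_def J_skew[of x A])

text \<open>Contracting \<theta> \<and> \<omega> with \<xi> yields a multiple of \<theta> \<and>
  \<theta>, which is zero; hence \<open>ad \<xi>\<close> preserves \<omega>.\<close>

lemma d_omega_\<xi>: "J (br \<xi> y) \<bullet> z = - (J y \<bullet> br \<xi> z)"
  using d_omega[of \<xi> y z] antisym[of \<xi> z]
  by (simp add: J.neg inner_commute[of y A] J_skew[of "br \<xi> z" y] inner_commute[of "J y"] algebra_simps)

text \<open>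
  Integrability at \<open>A\<close> expresses the skew-symmetric operator \<open>[J, ad A]\<close> as the symmetric part of
  \<open>ad \<xi>\<close> (up to a factor), so both vanish.
\<close>

lemma A_commutes_J: "br A (J y) = J (br A y)" and \<xi>_killing: "br \<xi> y \<bullet> z = - (y \<bullet> br \<xi> z)"
proof -
  have 1: "J (br A y) - br A (J y) = br \<xi> y + J (br \<xi> (J y))" for y
  proof -
    have "br (J A) (J (J y)) - br A (J y) - J (br (J A) (J y) + br A (J (J y))) = 0"
      by (rule integrable)
    then show ?thesis
      by (simp add: J.neg J.add J.diff br.minus_right algebra_simps flip: \<xi>_def)
  qed
  have 2: "J (br \<xi> (J y)) \<bullet> z = y \<bullet> br \<xi> z" for y z
    using d_omega_\<xi>[of "J y" z] by simp
  have 3: "(J (br A y) - br A (J y)) \<bullet> z = - ((J (br A z) - br A (J z)) \<bullet> y)" for y z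
    using A_killing[of y "J z"] A_killing[of "J y" z] J_skew[of y "br A z"]
      J_skew[of "br A y" z]
    by (simp add: inner_diff_left inner_diff_right inner_commute)
  have 4: "(J (br A y) - br A (J y)) \<bullet> z = br \<xi> y \<bullet> z + y \<bullet> br \<xi> z" for y z
    unfolding 1 by (simp add: inner_add_left 2)
  have 5: "(J (br A y) - br A (J y)) \<bullet> z = 0" for y z
    using 3[of y z] 4[of y z] 4[of z y] by (simp add: inner_commute)
  have "(J (br A y) - br A (J y)) \<bullet> (J (br A y) - br A (J y)) = 0" by (rule 5)
  then show "br A (J y) = J (br A y)" by simp
  show "br \<xi> y \<bullet> z = - (y \<bullet> br \<xi> z)" using 4[of y z] 5[of y z] by simp
qed

lemma A_\<xi> [simp]: "br A \<xi> = 0" "br \<xi> A = 0"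
  using A_commutes_J[of A] self[of A] antisym[of A \<xi>] J.zero by (simp_all add: \<xi>_def)

text \<open>Put \<open>A\<close> into the first slot of d\<omega> = \<theta> \<and> \<omega>: since
  \<open>ad A\<close> is skew and commutes with \<open>J\<close>, its two terms cancel.\<close>

lemma bracket_\<xi>:
  assumes "y \<bullet> A = 0" "z \<bullet> A = 0"
  shows "br y z \<bullet> \<xi> = J y \<bullet> z"
proof -
  have "J (br A z) \<bullet> y = J (br A y) \<bullet> z"
    using A_killing[of "J y" z] J_skew[of y "br A z"] by (simp add: A_commutes_J inner_commute)
  then show ?thesis using d_omega[of A y z] antisym[of A z] assms by (simp add: J.neg)
qed

section \<open>Unimodularity and centrality of \<open>J A\<close>\<close>

lemma trace_ad_zero:
  assumes "orthonormal_basis UNIV B"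
  shows "(\<Sum>e\<in>B. br x e \<bullet> e) = 0"
proof -
  have "bilinear (\<lambda>a b. br x a \<bullet> b)"
    by (auto intro!: linearI simp: bilinear_def br.add_right br.scaleR_right inner_add_left inner_add_right)
  from bilinear_trace_basis_independent[OF this assms orthonormal_basis_Basis]
  show ?thesis using unimodular by (simp add: unimodular_def endo_trace_def)
qed

lemma J_surj: "J ` UNIV = UNIV"
  by (metis J_J J.neg surj_def add.inverse_inverse)

text \<open>Contract d\<omega> = \<theta> \<and> \<omega> over the pairs \<open>e\<close>,
  \<open>J e\<close>. On the left the extra terms are traces of \<open>ad x\<close> in the bases of
  the \<open>e\<close> and of the \<open>J e\<close>, zero by unimodularity; on the right there
  remains \<open>DIM('a) - 2\<close> times \<theta>.\<close>

lemma sum_bracket_J: "(\<Sum>e\<in>Basis. br e (J e)) = (real DIM('a) - 2) *\<^sub>R \<xi>"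
proof -
  define S where "S = (\<Sum>e\<in>Basis. br e (J e))"
  have JS: "J S \<bullet> x = (- (real DIM('a) - 2) *\<^sub>R A) \<bullet> x" for x
  proof -
    note B = orthonormal_basis_Basis
    have a: "- (J (br e (J e)) \<bullet> x) - br x (J e) \<bullet> J e - br x e \<bullet> e =
        (x \<bullet> A) - (e \<bullet> A) * (e \<bullet> x) - (J x \<bullet> e) * (e \<bullet> \<xi>)" if e: "e \<in> Basis" for e
      using d_omega[of e "J e" x] antisym[of x "J e"] e J_skew[of "br x (J e)" e]
      by (simp add: J.neg algebra_simps)
    have "bilinear (\<lambda>a b. br x a \<bullet> b)"
      by (auto intro!: linearI simp: bilinear_def br.add_right br.scaleR_right inner_add_left inner_add_right)
    from bilinear_trace_isometry[OF this B linear_J J_surj]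
    have b: "(\<Sum>e\<in>Basis. br x (J e) \<bullet> J e) = 0" using trace_ad_zero[OF B] by simp
    have c: "(\<Sum>e\<in>Basis. (e \<bullet> A) * (e \<bullet> x)) = A \<bullet> x"
      "(\<Sum>e\<in>Basis. (J x \<bullet> e) * (e \<bullet> \<xi>)) = x \<bullet> A"
      using orthonormal_basis_inner_sum[OF B, of A x] orthonormal_basis_inner_sum[OF B, of "J x" \<xi>]
      by (simp_all add: inner_commute)
    have "(\<Sum>e\<in>Basis. - (J (br e (J e)) \<bullet> x) - br x (J e) \<bullet> J e - br x e \<bullet> e) =
        (\<Sum>e\<in>Basis. (x \<bullet> A) - (e \<bullet> A) * (e \<bullet> x) - (J x \<bullet> e) * (e \<bullet> \<xi>))"
      by (rule sum.cong[OF refl a])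
    then have "- (J S \<bullet> x) = real DIM('a) * (x \<bullet> A) - A \<bullet> x - x \<bullet> A"
      by (simp add: sum_subtractf sum_negf b c trace_ad_zero[OF B] S_def J.sum inner_sum_left)
    then show ?thesis by (simp add: inner_commute algebra_simps)
  qed
  have "(J S - - (real DIM('a) - 2) *\<^sub>R A) \<bullet> (J S - - (real DIM('a) - 2) *\<^sub>R A) = 0"
    using JS by (simp add: inner_diff_left)
  then have "J S = - (real DIM('a) - 2) *\<^sub>R A" by simp
  then have "J (J S) = J (- (real DIM('a) - 2) *\<^sub>R A)" by (rule arg_cong)
  then have "- S = - ((real DIM('a) - 2) *\<^sub>R \<xi>)"
    by (simp add: J.scaleR J.neg \<xi>_def del: minus_diff_eq)
  then show ?thesis by (simp flip: S_def)
qed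

lemma \<xi>_central [simp]: "br \<xi> x = 0" "br x \<xi> = 0"
proof -
  have "br \<xi> x = 0"
  proof (cases "DIM('a) = 2")
    case True
    \<comment> \<open>In dimension two the bracket sum is zero and says nothing about \<xi>, but
      \<open>A\<close> and \<xi> already span the space and commute.\<close>
    have "A \<noteq> \<xi>" "A \<noteq> 0" "\<xi> \<noteq> 0" using \<xi>_A A_A \<xi>_\<xi> by force+
    then have "independent {A, \<xi>}"
      by (intro pairwise_orthogonal_independent) (auto simp: pairwise_def orthogonal_def)
    then have "UNIV \<subseteq> span {A, \<xi>}"
      using True \<open>A \<noteq> \<xi>\<close> by (intro card_ge_dim_independent) auto
    moreover have "linear (br \<xi>)" by (rule linearI) (simp_all add: br.add_right br.scaleR_right)
    moreover have "br \<xi> e = 0" if "e \<in> {A, \<xi>}" for e using that self[of \<xi>] by auto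
    ultimately show ?thesis using linear_eq_0_on_span[of "br \<xi>" "{A, \<xi>}" x] by blast
  next
    case False
    let ?S = "{br x y |x y. x \<in> UNIV \<and> y \<in> UNIV}"
    have "(\<Sum>e\<in>Basis. br e (J e)) \<in> span ?S"
      by (intro span_sum span_base) blast
    then have "(1 / (real DIM('a) - 2)) *\<^sub>R (real DIM('a) - 2) *\<^sub>R \<xi> \<in> span ?S"
      unfolding sum_bracket_J by (rule span_scale)
    then have "\<xi> \<in> span ?S" using False by simp
    moreover obtain n where "derived_series UNIV br n = {0}"
      using solvable unfolding lie_solvable_def by blast
    ultimately show ?thesis using skew_ad_zero[OF refl _ \<xi>_killing, of n] by simp
  qed
  then show "br \<xi> x = 0" "br x \<xi> = 0" using antisym[of \<xi> x] by simp_all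
qed

section \<open>The Kaehler algebra on the orthogonal complement of \<open>A\<close> and
  \<open>J A\<close>\<close>

definition H :: "'a set" where "H = {x. x \<bullet> A = 0}"

definition K :: "'a set" where "K = {x. x \<bullet> A = 0 \<and> x \<bullet> \<xi> = 0}"

text \<open>On \<open>K\<close> this is the bracket projected along \<xi>, by
  \<open>bracket_\<xi>\<close>; written with \<omega> it is bilinear everywhere and matches the
  cocycle formula of a central extension.\<close>

definition brK :: "'a \<Rightarrow> 'a \<Rightarrow> 'a" where "brK x y = br x y - (J x \<bullet> y) *\<^sub>R \<xi>"

lemma subspace_H: "subspace H" and subspace_K: "subspace K"
  by (auto simp: subspace_def H_def K_def inner_add_left)

sublocale H: metric_lie_algebra H br
  by unfold_locales (simp_all add: subspace_H bilin self jacobi, simp add: H_def)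

lemma brK_in: "x \<in> K \<Longrightarrow> y \<in> K \<Longrightarrow> brK x y \<in> K"
  by (simp add: K_def brK_def inner_diff_left bracket_\<xi>)

lemma J_self [simp]: "J x \<bullet> x = 0"
  using J_skew[of x x] by (simp add: inner_commute)

text \<open>\<theta> vanishes on \<open>K\<close>, so d\<omega> does too. The same identity serves
  as the cocycle condition for \<open>brK\<close>.\<close>

lemma omega_closed:
  assumes "x \<in> K" "y \<in> K" "z \<in> K"
  shows "J (br x y) \<bullet> z + J (br y z) \<bullet> x + J (br z x) \<bullet> y = 0"
  using d_omega[of x y z] assms by (simp add: K_def)

lemma bilinear_brK: "bilinear brK"
  by (auto intro!: linearI simp: bilinear_def brK_def br.add_left br.add_right br.scaleR_left
      br.scaleR_right J.add J.scaleR inner_add_left inner_add_right algebra_simps)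

sublocale K: kaehler_lie_algebra K brK J
proof
  fix x y z assume xyz: "x \<in> K" "y \<in> K" "z \<in> K"
  have A0: "x \<bullet> A = 0" "y \<bullet> A = 0" "z \<bullet> A = 0" using xyz by (simp_all add: K_def)
  have om: "J x \<bullet> br y z + J y \<bullet> br z x + J z \<bullet> br x y = 0"
    using omega_closed[OF xyz] J_skew[of "br x y" z] J_skew[of "br y z" x] J_skew[of "br z x" y]
    by (simp only: inner_commute[of "J _" "br _ _"])
  \<comment> \<open>Since \<xi> is central, the inner corrections drop out and only the cyclic sum
    of \<omega> along \<xi> remains.\<close>
  have "brK x (brK y z) + brK y (brK z x) + brK z (brK x y) =
      - (J x \<bullet> br y z + J y \<bullet> br z x + J z \<bullet> br x y) *\<^sub>R \<xi>"
    using jacobi[of x y z]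
    by (simp add: brK_def br.diff_right br.scaleR_right inner_diff_right A0 algebra_simps)
  then show "brK x (brK y z) + brK y (brK z x) + brK z (brK x y) = 0" by (simp add: om)
  show "d2 brK (fundamental_form J (\<bullet>)) x y z = 0"
    using omega_closed[OF xyz] xyz
    by (simp add: d2_def fundamental_form_def brK_def J.diff J.scaleR inner_add_left inner_diff_left K_def
        inner_commute[of A])
next
  fix x y assume "x \<in> K" "y \<in> K"
  show "brK (J x) (J y) - brK x y - J (brK (J x) y + brK x (J y)) = 0"
  \<comment> \<open>\<omega> is \<open>J\<close>-invariant, so the corrections along \<xi> cancel
    within each group of brackets.\<close>
  proof -
    have "J x \<bullet> y = - (J y \<bullet> x)" using J_skew[of x y] by (simp add: inner_commute)
    then show ?thesis using integrable[of x y]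
      by (simp add: brK_def J.add J.diff J.scaleR inner_commute[of x "J y"] algebra_simps)
  qed
next
  fix x assume "x \<in> K"
  show "brK x x = 0" by (simp add: brK_def self)
  show "J x \<in> K" using \<open>x \<in> K\<close> by (simp add: K_def)
qed ((fact subspace_K bilinear_brK brK_in linear_J)+, simp_all)

text \<open>Adjoining \<open>A\<close> and \<xi> to \<open>B\<close> gives an orthonormal basis of
  the whole space. They add nothing to the trace, brackets being orthogonal to \<open>A\<close> and
  \<xi> central, and the correction in \<open>brK\<close> is orthogonal to \<open>B\<close>.\<close>

lemma K_unimodular:
  assumes B: "orthonormal_basis K B" and x: "x \<in> K"
  shows "(\<Sum>e\<in>B. brK x e \<bullet> e) = 0"
proof -
  have BK: "e \<bullet> A = 0" "e \<bullet> \<xi> = 0" if "e \<in> B" for e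
    using orthonormal_basis_in[OF B that] by (simp_all add: K_def)
  have nin: "A \<notin> B" "\<xi> \<notin> B" "A \<noteq> \<xi>" using BK A_A \<xi>_\<xi> \<xi>_A by force+
  have "span (insert A (insert \<xi> B)) = UNIV"
  proof -
    have "y \<in> span (insert A (insert \<xi> B))" for y
    proof -
      have "y - (y \<bullet> A) *\<^sub>R A - (y \<bullet> \<xi>) *\<^sub>R \<xi> \<in> K" by (simp add: K_def inner_diff_left)
      then have "y - (y \<bullet> A) *\<^sub>R A - (y \<bullet> \<xi>) *\<^sub>R \<xi> \<in> span (insert A (insert \<xi> B))"
        using B span_mono[of B "insert A (insert \<xi> B)"] by (auto simp: orthonormal_basis_def)
      then have "(y - (y \<bullet> A) *\<^sub>R A - (y \<bullet> \<xi>) *\<^sub>R \<xi>) + ((y \<bullet> A) *\<^sub>R A + (y \<bullet> \<xi>) *\<^sub>R \<xi>)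
          \<in> span (insert A (insert \<xi> B))"
        by (intro span_add span_scale) (auto intro: span_base)
      then show ?thesis by simp
    qed
    then show ?thesis by blast
  qed
  then have "orthonormal_basis UNIV (insert A (insert \<xi> B))"
    using B BK
    by (auto simp: orthonormal_basis_def pairwise_insert orthogonal_def norm_eq_1 inner_commute)
  from trace_ad_zero[OF this, of x] have "(\<Sum>e\<in>B. br x e \<bullet> e) = 0"
    using nin orthonormal_basis_finite[OF B] by simp
  moreover have "brK x e \<bullet> e = br x e \<bullet> e" if "e \<in> B" for e
    using BK[OF that] by (simp add: brK_def inner_diff_left inner_commute[of \<xi>])
  ultimately show ?thesis by simp
qed

text \<open>The projection \<open>P\<close> along \<xi> restricts to a Lie algebra homomorphism from
  \<open>H\<close> onto \<open>K\<close>, so the derived series of \<open>K\<close> lies in the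
  image of that of \<open>H\<close>.\<close>

lemma K_solvable: "\<exists>n. derived_series K brK n \<subseteq> {0}"
proof -
  obtain n where n: "derived_series UNIV br n = {0}"
    using solvable unfolding lie_solvable_def by blast
  define P where "P x = x - (x \<bullet> \<xi>) *\<^sub>R \<xi>" for x
  have linP: "linear P" by (rule linearI) (simp_all add: P_def inner_add_left algebra_simps)
  have sub: "derived_series K brK k \<subseteq> P ` H.D k" for k
  proof (induction k)
    case 0
    have "x \<in> P ` H" if "x \<in> K" for x
      using that by (intro image_eqI[of _ _ x]) (simp_all add: K_def H_def P_def)
    then show ?case by auto
  next
    case (Suc k)
    have "brK x y \<in> P ` H.D (Suc k)" if xy: "x \<in> derived_series K brK k" "y \<in> derived_series K brK k"
      for x y
    proof -
      obtain x' y' where *: "x' \<in> H.D k" "y' \<in> H.D k" "x = P x'" "y = P y'"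
        using Suc xy by blast
      have "x' \<bullet> A = 0" "y' \<bullet> A = 0" using *(1,2) H.D_sub by (auto simp: H_def)
      then have "brK x y = P (br x' y')"
        by (simp add: *(3,4) P_def brK_def bracket_\<xi> br.diff_left br.diff_right br.scaleR_left
            br.scaleR_right J.diff J.scaleR inner_add_left inner_diff_left inner_diff_right inner_commute[of A])
      then show ?thesis using H.D_bracket[OF *(1,2)] by blast
    qed
    then show ?case
      unfolding derived_series.simps(2)[of K]
      by (intro span_minimal linear_subspace_image linP H.subspace_D) blast
  qed
  have "H.D n \<subseteq> {0}" using derived_series_mono[of H UNIV br n] n by simp
  then have "P ` H.D n \<subseteq> {0}" by (auto simp: P_def)
  then show ?thesis using sub[of n] by blast
qed

lemma K_flat: "flat_metric K brK (\<bullet>)"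
proof -
  obtain n where "derived_series K brK n \<subseteq> {0}" using K_solvable by blast
  from solvable_neg_scal[OF K.metric_lie_algebra_axioms this]
  obtain B where "orthonormal_basis K B" "neg_scal brK B = 0 \<longrightarrow> flat_metric K brK (\<bullet>)" by blast
  then show ?thesis using K.neg_scal_zero K_unimodular by blast
qed

lemma K_kaehler_flat: "kaehler_flat_lie_algebra K brK J (\<bullet>)"
  unfolding kaehler_flat_lie_algebra_def kaehler_structure_def hermitian_structure_def
    complex_structure_def
proof (intro conjI ballI K.is_lie_algebra K_flat K.integrable K.d_omega)
  show "endomorphism_on K J"
    using K.J_in by (auto simp: endomorphism_on_def linear_on_def J.add J.scaleR)
  show "inner_product_on K (\<bullet>)"
    by (auto simp: inner_product_on_def bilinear_on_def linear_on_def inner_add_left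
        inner_add_right inner_commute)
qed auto

section \<open>Central extension, semidirect product and the derivation of \<open>K\<close>\<close>

lemma kernel_\<theta>: "{x. \<theta> x = 0} = H"
  by (simp add: \<theta>_eq H_def)

lemma central_extension:
  "is_central_extension K brK (fundamental_form J (\<bullet>)) \<xi> H br"
  unfolding is_central_extension_def
proof (intro conjI allI ballI)
  show "lie_algebra K brK" by (rule K.is_lie_algebra)
  show "closed_two_form K brK (fundamental_form J (\<bullet>))"
    using K.d_omega
    by (auto simp: closed_two_form_def two_form_on_def bilinear_on_def linear_on_def
        fundamental_form_def J.add J.scaleR inner_add_left inner_add_right)
  show "\<xi> \<notin> K" by (simp add: K_def)
  have "\<exists>s y. x = s *\<^sub>R \<xi> + y \<and> y \<in> K" if "x \<in> H" for x
    using that by (intro exI[of _ "x \<bullet> \<xi>"] exI[of _ "x - (x \<bullet> \<xi>) *\<^sub>R \<xi>"])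
      (simp add: H_def K_def inner_diff_left)
  then show "H = {s *\<^sub>R \<xi> + x |s x. x \<in> K}"
    by (auto simp: H_def K_def inner_add_left)
  show "br (s *\<^sub>R \<xi> + x) (t *\<^sub>R \<xi> + y) = fundamental_form J (\<bullet>) x y *\<^sub>R \<xi> + brK x y" for s t x y
    by (simp add: br.add_left br.add_right br.scaleR_left br.scaleR_right brK_def fundamental_form_def)
qed

lemma A_derivation: "br A (br x y) = br (br A x) y + br x (br A y)"
  using jacobi[of A x y] antisym[of A y] antisym[of "br A x" y]
  by (simp add: br.minus_right algebra_simps)

lemma semidirect_product: "is_semidirect_product H br (br A) A UNIV br"
  unfolding is_semidirect_product_def
proof (intro conjI allI ballI)
  show "lie_algebra H br" by (rule H.is_lie_algebra)
  show "derivation_on H br (br A)"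
    by (auto simp: derivation_on_def endomorphism_on_def linear_on_def br.add_right br.scaleR_right
        A_derivation H_def)
  show "A \<notin> H" by (simp add: H_def)
  have "\<exists>s y. x = s *\<^sub>R A + y \<and> y \<in> H" for x
    by (intro exI[of _ "x \<bullet> A"] exI[of _ "x - (x \<bullet> A) *\<^sub>R A"]) (simp add: H_def inner_diff_left)
  then show "UNIV = {s *\<^sub>R A + v |s v. v \<in> H}" by blast
  show "br (s *\<^sub>R A + v) (t *\<^sub>R A + w) = s *\<^sub>R br A w - t *\<^sub>R br A v + br v w" for s t v w
    using antisym[of A v] self[of A]
    by (simp add: br.add_left br.add_right br.scaleR_left br.scaleR_right algebra_simps)
qed

text \<open>\<open>ad A\<close> is skew and kills \<xi>, so it preserves \<open>K\<close>; as it
  also commutes with \<open>J\<close> it preserves \<omega>, hence the correction term of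
  \<open>brK\<close>.\<close>

lemma K_derivation: "derivation_on K brK (br A)"
proof -
  have "br A x \<in> K" if "x \<in> K" for x
    using A_killing[of x \<xi>] by (simp add: K_def)
  moreover have "br A (brK x y) = brK (br A x) y + brK x (br A y)" for x y
    using A_killing[of "J x" y]
    by (simp add: brK_def A_derivation br.diff_right br.scaleR_right A_commutes_J algebra_simps)
  ultimately show ?thesis
    by (auto simp: derivation_on_def endomorphism_on_def linear_on_def br.add_right br.scaleR_right)
qed

end

theorem theorem3p9:
  fixes br :: "'a::euclidean_space \<Rightarrow> 'a \<Rightarrow> 'a"
    and J :: "'a \<Rightarrow> 'a"
    and \<theta> :: "'a \<Rightarrow> real"
    and A :: 'a
  assumes "lie_algebra UNIV br"
    and "lie_solvable UNIV br"
    and "unimodular br"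
    and "vaisman_structure UNIV br J (\<bullet>) \<theta>"
    and "\<theta> \<noteq> (\<lambda>x. 0)"
    and "A \<in> orthogonal_comp {x. \<theta> x = 0}"
    and "\<theta> A = 1"
    and "norm A = 1"
  shows "\<exists>K brK JK ipK.
      kaehler_flat_lie_algebra K brK JK ipK \<and>
      K \<subseteq> {x. \<theta> x = 0} \<and>
      (\<forall>x\<in>K. \<forall>y\<in>K. fundamental_form J (\<bullet>) x y = fundamental_form JK ipK x y) \<and>
      is_central_extension K brK (fundamental_form J (\<bullet>)) (J A) {x. \<theta> x = 0} br \<and>
      is_double_extension K brK (br A) (fundamental_form J (\<bullet>)) A (J A) UNIV br \<and>
      derivation_on K brK (br A) \<and>
      (\<forall>x\<in>K. \<forall>y\<in>K. ipK (br A x) y = - ipK x (br A y)) \<and>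
      (\<forall>x\<in>K. br A (JK x) = JK (br A x))"
proof -
  interpret unimodular_solvable_vaisman br J \<theta> A
    using assms by unfold_locales
  have "is_double_extension K brK (br A) (fundamental_form J (\<bullet>)) A \<xi> UNIV br"
    unfolding is_double_extension_def using central_extension semidirect_product by blast
  \<comment> \<open>The complex structure and metric of \<open>K\<close> are restrictions; as only
    values on \<open>K\<close> matter, \<open>J\<close> and \<open>(\<bullet>)\<close> themselves
    are the witnesses.\<close>
  then show ?thesis
    unfolding kernel_\<theta> \<xi>_def[symmetric]
    using K_kaehler_flat central_extension K_derivation A_killing A_commutes_J
    by (intro exI[of _ K] exI[of _ brK] exI[of _ J] exI[of _ "(\<bullet>)"]) (auto simp: K_def H_def)
qed

end
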